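(* Let $(T,F)$ be a rooted tree with a source over $(Q,\rho)$ and let $M:=M(T,F)$ be the associated rooted tree module. The following are equivalent: (1) $M$ is indecomposable; (2) there is no non-identity idempotent quiver morphism $\iota:T\to T$ satisfying $F\circ\iota=F$; (3) there does not exist a generalized graph map $\mathcal M=(\mathcal M_0,\mathcal M_1,\mathcal E_{\mathcal M})$ from $M$ to itself with some $(n_1,n_2)\in\pi(\mathcal M_0)$ satisfying $n_1\neq n_2$, $\mathsf p(n_1)=\mathsf p(n_2)$ and $F(a_{n_1})=F(a_{n_2})$.
   Context: Fix a field $\mathcal K$ with $\mathrm{char}(\mathcal K)\neq 2$. Let $Q=(Q_0,Q_1,\varsigma,\varepsilon)$ be a quiver and $\rho$ a set of paths in $Q$ of length at least $2$ that bounds the length of the paths, not lying in the ideal $\langle\rho\rangle$, passing through any vertex. Put $\Lambda:=\mathcal KQ/\langle\rho\rangle$. Finite-dimensional $\Lambda$-modules are identified with finite-dimensional $\mathcal K$-representations of $(Q,\rho)$. A tree is a finite quiver $T=(T_0,T_1,s,t)$ whose underlying undirected graph is connected without cycles. Here rooted trees have a unique source $\ast$ (the root). For $n\in T_0\setminus\{\ast\}$ there is a unique arrow with target $n$, denoted $a_n$; its source is the parent $\mathsf p(n)$. A quiver morphism is a pair of maps (on vertices and on arrows) commuting with sources and targets. A quiver morphism $F:T\to Q$ is bound, written $F:T\to(Q,\rho)$, if there is no path $p$ in $T$ with $F(p)\in\langle\rho\rangle$; then $(T,F)$ is a tree over $(Q,\rho)$. The rooted tree module (RTM) $M(T,F)$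 has $\mathcal K$-basis $\{v_n\mid n\in T_0\}$, with $v_n$ at the vertex $F(n)$, and $\gamma\in Q_1$ acts by $\gamma\cdot v_n=\sum_{a\in T_1,\ s(a)=n,\ F(a)=\gamma}v_{t(a)}$. Let $(T^1,F_1),(T^2,F_2)$ be rooted trees with sources over $(Q,\rho)$, $M_j=M(T^j,F_j)$; in $T^2$ the arrow with target $m$ is written $b_m$. (For GGMs from $M$ to itself take both equal to $(T,F)$, with $b_m=a_m$.) Networks. A network consists of a quiver together with a set of undirected edges forming a simple graph on the same vertex set. The pullback network $\mathcal N[1]$ has vertices $\mathcal N[1]_0=\{(n,m)\in T^1_0\times T^2_0\mid F_1(n)=F_2(m)\}$; arrows $\mathcal N[1]_1$: $(a_n,b_m):(\mathsf p(n),\mathsf p(m))\to(n,m)$ whenever $F_1(a_n)=F_2(b_m)$; edges $\mathcal E^1=\{\{(n,m),(n',m)\}\mid n\ne n',\ \mathsf p(n)=\mathsf p(n'),\ F_1(a_n)=F_1(a_{n'})\}$. The 2-covering network $\mathcal N[2]$ has $\mathcal N[2]_l=\mathcal N[1]_l\times\{-1,1\}$ for $l=0,1$ (sources and targets keep the sign) and edges $\mathcal E^2=\{\{(n,m,i),(n',m,-i)\}\mid\{(n,m),(n',m)\}\in\mathcal E^1,\ i\in\{-1,1\}\}$; $\pi:\mathcal N[2]\to\mathcal N[1]$ forgets the sign. A link is an arrow, a formal inverse of an arrow, or an edge. A traversal is a walk along links containing no $\alpha\alpha^{-1}$ as a subwalk (with $(\alpha^{-1})^{-1}=\alpha$ for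 an arrow and $\alpha^{-1}=\alpha$ for an edge); vertices are traversals of length $0$. A triangle in $\mathcal N[1]$ is an induced subnetwork on three vertices whose total number of arrows and edges is $3$. $\mathcal R[1]$ is the set of length-two traversals in $\mathcal N[1]$ through three vertices inducing a triangle, and $\mathcal R[2]$ is the set of traversals $\mathfrak t$ in $\mathcal N[2]$ with $\pi(\mathfrak t)\in\mathcal R[1]$. A subnetwork $\mathcal M=(\mathcal M_0,\mathcal M_1,\mathcal E_{\mathcal M})$ of $\mathcal N[2]$ is: $\mathcal R[2]$-free if no traversal in $\mathcal M$ lies in $\mathcal R[2]$; involution-free if $(n,m,j)\in\mathcal M_0$ implies $(n,m,-j)\notin\mathcal M_0$; connected if there is a traversal in $\mathcal M$ between any two of its vertices; complete if for each $(n,m,j)\in\mathcal M_0$: (i) if there is an arrow $a_n:n'\to n$ in $T^1$, then at least one of the following holds: there is an arrow $b_m:m'\to m$ in $T^2$ such that $(a_n,b_m,j):(n',m',j)\to(n,m,j)$ is in $\mathcal M_1$; or there is an arrow $a_{n''}:n'\to n''$ in $T^1$ with $F_1(a_n)=F_1(a_{n''})$, $(n'',m,-j)\in\mathcal M_0$ and $\{(n,m,j),(n'',m,-j)\}\in\mathcal E_{\mathcal M}$; (ii) for every arrow $b_{m'}:m\to m'$ in $T^2$ there is an arrow $a_{n'}:n\to n'$ in $T^1$ such that $(a_{n'},b_{m'},j):(n,m,j)\to(n',m',j)$ is in $\mathcal M_1$. A generalized graph map (GGM) from $M_1$ to $M_2$ is a non-empty, complete, connected, $\mathcal R[2]$-free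 and involution-free subnetwork of $\mathcal N[2]$. *)

theory Defs
  imports
    "Graph_Theory.Digraph_Component"
    "HOL-Library.Poly_Mapping"
begin

section \<open>Quivers with monomial relations\<close>

text \<open>
  A quiver is a digraph with parallel arcs and loops allowed, i.e. an instance of
  \<^locale>\<open>wf_digraph\<close>; it need not be finite. A path is a pair of its starting vertex and the
  list of its arrows in the order in which they are traversed, so \<open>(u, [])\<close> is the path of
  length 0 at \<open>u\<close>.
\<close>

type_synonym ('q, 'a) path = "'q \<times> 'a list"

definition paths :: "('q, 'a) pre_digraph \<Rightarrow> ('q, 'a) path set" where
  "paths Q = {(u, p). \<exists>v. pre_digraph.awalk Q u p v}"

definition path_end :: "('q, 'a) pre_digraph \<Rightarrow> ('q, 'a) path \<Rightarrow> 'q" where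
  "path_end Q p = pre_digraph.awlast Q (fst p) (snd p)"

definition path_verts :: "('q, 'a) pre_digraph \<Rightarrow> ('q, 'a) path \<Rightarrow> 'q set" where
  "path_verts Q p = set (pre_digraph.awalk_verts Q (fst p) (snd p))"

text \<open>
  The path algebra consists of the formal linear combinations of paths; the product of \<open>p\<close> and
  \<open>q\<close> is their concatenation \<open>p\<close> followed by \<open>q\<close>, or 0. (The opposite convention yields the same
  two-sided ideals.)
\<close>

definition path_algebra :: "('q, 'a) pre_digraph \<Rightarrow> (('q, 'a) path \<Rightarrow>\<^sub>0 'k::field) set" where
  "path_algebra Q = {x. Poly_Mapping.keys x \<subseteq> paths Q}"

definition path_times ::
  "('q, 'a) pre_digraph \<Rightarrow> (('q, 'a) path \<Rightarrow>\<^sub>0 'k::field) \<Rightarrow> (('q, 'a) path \<Rightarrow>\<^sub>0 'k) \<Rightarrow> (('q, 'a) path \<Rightarrow>\<^sub>0 'k)"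
where
  "path_times Q x y =
    (\<Sum>p\<in>Poly_Mapping.keys x. \<Sum>q\<in>Poly_Mapping.keys y.
       if path_end Q p = fst q
       then Poly_Mapping.single (fst p, snd p @ snd q) (Poly_Mapping.lookup x p * Poly_Mapping.lookup y q)
       else 0)"

inductive_set path_ideal ::
  "('q, 'a) pre_digraph \<Rightarrow> ('q, 'a) path set \<Rightarrow> (('q, 'a) path \<Rightarrow>\<^sub>0 'k::field) set"
  for Q :: "('q, 'a) pre_digraph" and rho :: "('q, 'a) path set"
where
  generator: "p \<in> rho \<Longrightarrow> Poly_Mapping.single p 1 \<in> path_ideal Q rho"
| zero: "0 \<in> path_ideal Q rho"
| plus: "x \<in> path_ideal Q rho \<Longrightarrow> y \<in> path_ideal Q rho \<Longrightarrow> x + y \<in> path_ideal Q rho"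
| times_left: "x \<in> path_ideal Q rho \<Longrightarrow> y \<in> path_algebra Q \<Longrightarrow> path_times Q y x \<in> path_ideal Q rho"
| times_right: "x \<in> path_ideal Q rho \<Longrightarrow> y \<in> path_algebra Q \<Longrightarrow> path_times Q x y \<in> path_ideal Q rho"

definition path_in_ideal ::
  "'k::field itself \<Rightarrow> ('q, 'a) pre_digraph \<Rightarrow> ('q, 'a) path set \<Rightarrow> ('q, 'a) path \<Rightarrow> bool"
where
  "path_in_ideal K Q rho p \<longleftrightarrow> Poly_Mapping.single p (1 :: 'k) \<in> path_ideal Q rho"

text \<open>The bound on the lengths of paths is allowed to depend on the vertex.\<close>

definition quiver_with_relations ::
  "'k::field itself \<Rightarrow> ('q, 'a) pre_digraph \<Rightarrow> ('q, 'a) path set \<Rightarrow> bool"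
where
  "quiver_with_relations K Q rho \<longleftrightarrow>
     wf_digraph Q \<and> rho \<subseteq> paths Q \<and> (\<forall>p\<in>rho. 2 \<le> length (snd p)) \<and>
     (\<forall>v\<in>verts Q. \<exists>N. \<forall>p\<in>paths Q.
        v \<in> path_verts Q p \<and> \<not> path_in_ideal K Q rho p \<longrightarrow> length (snd p) \<le> N)"


section \<open>Representations\<close>

text \<open>
  The vector spaces at all vertices are subspaces of one ambient vector space with scalar
  multiplication \<open>scale\<close>.
\<close>

record ('q, 'a, 'w) representation =
  space :: "'q \<Rightarrow> 'w set"
  act :: "'a \<Rightarrow> 'w \<Rightarrow> 'w"

definition is_representation ::
  "('k::field \<Rightarrow> 'w::ab_group_add \<Rightarrow> 'w) \<Rightarrow> ('q, 'a) pre_digraph \<Rightarrow> ('q, 'a) path set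
     \<Rightarrow> ('q, 'a, 'w) representation \<Rightarrow> bool"
where
  "is_representation scale Q rho V \<longleftrightarrow>
     vector_space scale \<and>
     (\<forall>q\<in>verts Q. module.subspace scale (space V q)) \<and>
     (\<forall>g\<in>arcs Q.
        (\<forall>x\<in>space V (tail Q g). act V g x \<in> space V (head Q g)) \<and>
        (\<forall>x\<in>space V (tail Q g). \<forall>y\<in>space V (tail Q g). act V g (x + y) = act V g x + act V g y) \<and>
        (\<forall>c. \<forall>x\<in>space V (tail Q g). act V g (scale c x) = scale c (act V g x))) \<and>
     (\<forall>(u, p)\<in>rho. \<forall>x\<in>space V u. fold (act V) p x = 0)"

definition subrepresentation ::
  "('k::field \<Rightarrow> 'w::ab_group_add \<Rightarrow> 'w) \<Rightarrow> ('q, 'a) pre_digraph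
     \<Rightarrow> ('q, 'a, 'w) representation \<Rightarrow> ('q \<Rightarrow> 'w set) \<Rightarrow> bool"
where
  "subrepresentation scale Q V U \<longleftrightarrow>
     (\<forall>q\<in>verts Q. module.subspace scale (U q) \<and> U q \<subseteq> space V q) \<and>
     (\<forall>g\<in>arcs Q. act V g ` U (tail Q g) \<subseteq> U (head Q g))"

definition is_zero :: "('q, 'a) pre_digraph \<Rightarrow> ('q \<Rightarrow> 'w::zero set) \<Rightarrow> bool" where
  "is_zero Q U \<longleftrightarrow> (\<forall>q\<in>verts Q. U q = {0})"

definition direct_sum ::
  "('q, 'a) pre_digraph \<Rightarrow> ('q, 'a, 'w::ab_group_add) representation
     \<Rightarrow> ('q \<Rightarrow> 'w set) \<Rightarrow> ('q \<Rightarrow> 'w set) \<Rightarrow> bool"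
where
  "direct_sum Q V U W \<longleftrightarrow>
     (\<forall>q\<in>verts Q. space V q = {x + y | x y. x \<in> U q \<and> y \<in> W q} \<and> U q \<inter> W q = {0})"

definition indecomposable ::
  "('k::field \<Rightarrow> 'w::ab_group_add \<Rightarrow> 'w) \<Rightarrow> ('q, 'a) pre_digraph \<Rightarrow> ('q, 'a) path set
     \<Rightarrow> ('q, 'a, 'w) representation \<Rightarrow> bool"
where
  "indecomposable scale Q rho V \<longleftrightarrow>
     is_representation scale Q rho V \<and> \<not> is_zero Q (space V) \<and>
     (\<forall>U W. subrepresentation scale Q V U \<and> subrepresentation scale Q V W \<and> direct_sum Q V U W
        \<longrightarrow> is_zero Q U \<or> is_zero Q W)"


section \<open>Quiver morphisms\<close>

record ('n, 'e, 'q, 'a) qmor =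
  vmap :: "'n \<Rightarrow> 'q"
  amap :: "'e \<Rightarrow> 'a"

definition quiver_morphism ::
  "('n, 'e) pre_digraph \<Rightarrow> ('q, 'a) pre_digraph \<Rightarrow> ('n, 'e, 'q, 'a) qmor \<Rightarrow> bool"
where
  "quiver_morphism T Q F \<longleftrightarrow>
     (\<forall>n\<in>verts T. vmap F n \<in> verts Q) \<and>
     (\<forall>a\<in>arcs T. amap F a \<in> arcs Q \<and>
        tail Q (amap F a) = vmap F (tail T a) \<and> head Q (amap F a) = vmap F (head T a))"

text \<open>The values of a morphism outside its domain \<open>T\<close> are irrelevant.\<close>

definition qmor_eq ::
  "('n, 'e) pre_digraph \<Rightarrow> ('n, 'e, 'q, 'a) qmor \<Rightarrow> ('n, 'e, 'q, 'a) qmor \<Rightarrow> bool"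
where
  "qmor_eq T F G \<longleftrightarrow> (\<forall>n\<in>verts T. vmap F n = vmap G n) \<and> (\<forall>a\<in>arcs T. amap F a = amap G a)"

definition qmor_id :: "('n, 'e, 'n, 'e) qmor" where
  "qmor_id = \<lparr>vmap = id, amap = id\<rparr>"

definition qmor_comp ::
  "('m, 'f, 'q, 'a) qmor \<Rightarrow> ('n, 'e, 'm, 'f) qmor \<Rightarrow> ('n, 'e, 'q, 'a) qmor"
where
  "qmor_comp G F = \<lparr>vmap = vmap G \<circ> vmap F, amap = amap G \<circ> amap F\<rparr>"

definition bound_morphism ::
  "'k::field itself \<Rightarrow> ('q, 'a) pre_digraph \<Rightarrow> ('q, 'a) path set
     \<Rightarrow> ('n, 'e) pre_digraph \<Rightarrow> ('n, 'e, 'q, 'a) qmor \<Rightarrow> bool"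
where
  "bound_morphism K Q rho T F \<longleftrightarrow> quiver_morphism T Q F \<and>
     \<not> (\<exists>(n, p)\<in>paths T. path_in_ideal K Q rho (vmap F n, map (amap F) p))"


section \<open>Networks and traversals\<close>

record ('v, 'a) network =
  quiver :: "('v, 'a) pre_digraph"
  edges :: "'v set set"

definition is_network :: "('v, 'a) network \<Rightarrow> bool" where
  "is_network N \<longleftrightarrow> wf_digraph (quiver N) \<and>
     (\<forall>e\<in>edges N. \<exists>u\<in>verts (quiver N). \<exists>v\<in>verts (quiver N). u \<noteq> v \<and> e = {u, v})"

definition subnetwork :: "('v, 'a) network \<Rightarrow> ('v, 'a) network \<Rightarrow> bool" where
  "subnetwork M N \<longleftrightarrow>
     is_network M \<and> is_network N \<and> subgraph (quiver M) (quiver N) \<and> edges M \<subseteq> edges N"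

definition induced_subnetwork :: "('v, 'a) network \<Rightarrow> 'v set \<Rightarrow> ('v, 'a) network" where
  "induced_subnetwork N S = \<lparr>quiver = quiver N \<restriction> S, edges = {e \<in> edges N. e \<subseteq> S}\<rparr>"

datatype ('v, 'a) link = Arrow 'a | Inverse 'a | Edge "'v set"

fun link_inverse :: "('v, 'a) link \<Rightarrow> ('v, 'a) link" where
  "link_inverse (Arrow a) = Inverse a"
| "link_inverse (Inverse a) = Arrow a"
| "link_inverse (Edge e) = Edge e"

fun link_joins :: "('v, 'a) network \<Rightarrow> ('v, 'a) link \<Rightarrow> 'v \<Rightarrow> 'v \<Rightarrow> bool" where
  "link_joins N (Arrow a) u v \<longleftrightarrow>
     a \<in> arcs (quiver N) \<and> tail (quiver N) a = u \<and> head (quiver N) a = v"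
| "link_joins N (Inverse a) u v \<longleftrightarrow>
     a \<in> arcs (quiver N) \<and> head (quiver N) a = u \<and> tail (quiver N) a = v"
| "link_joins N (Edge e) u v \<longleftrightarrow> e \<in> edges N \<and> e = {u, v}"

text \<open>
  A walk is given by its starting vertex and the list of its links, each paired with the vertex
  to which it leads.
\<close>

type_synonym ('v, 'a) walk = "'v \<times> (('v, 'a) link \<times> 'v) list"

fun walk_from :: "('v, 'a) network \<Rightarrow> 'v \<Rightarrow> (('v, 'a) link \<times> 'v) list \<Rightarrow> bool" where
  "walk_from N u [] \<longleftrightarrow> u \<in> verts (quiver N)"
| "walk_from N u ((l, v) # xs) \<longleftrightarrow> u \<in> verts (quiver N) \<and> link_joins N l u v \<and> walk_from N v xs"

definition walk_verts :: "('v, 'a) walk \<Rightarrow> 'v list" where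
  "walk_verts t = fst t # map snd (snd t)"

definition traversals :: "('v, 'a) network \<Rightarrow> ('v, 'a) walk set" where
  "traversals N = {(u, xs). walk_from N u xs \<and>
     successively (\<lambda>l l'. l' \<noteq> link_inverse l) (map fst xs)}"

definition network_connected :: "('v, 'a) network \<Rightarrow> bool" where
  "network_connected N \<longleftrightarrow>
     (\<forall>u\<in>verts (quiver N). \<forall>v\<in>verts (quiver N).
        \<exists>t\<in>traversals N. fst t = u \<and> last (walk_verts t) = v)"


section \<open>Rooted trees and their modules\<close>

text \<open>
  The constant \<^const>\<open>tree\<close> of the library only forbids directed cycles, so cycles of the underlying
  undirected multigraph are introduced here. Loops (length 1) and pairs of distinct arrows between
  the same two vertices (length 2) are cycles; going back along the same arrow is excluded by the
  definition of a traversal.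
\<close>

definition undirected_cycle :: "('n, 'e) pre_digraph \<Rightarrow> ('n, 'e) walk \<Rightarrow> bool" where
  "undirected_cycle T t \<longleftrightarrow>
     t \<in> traversals \<lparr>quiver = T, edges = {}\<rparr> \<and> snd t \<noteq> [] \<and>
     fst t = last (walk_verts t) \<and> distinct (tl (walk_verts t))"

definition undirected_tree :: "('n, 'e) pre_digraph \<Rightarrow> bool" where
  "undirected_tree T \<longleftrightarrow> fin_digraph T \<and> connected T \<and> (\<nexists>t. undirected_cycle T t)"

definition rooted_tree :: "('n, 'e) pre_digraph \<Rightarrow> bool" where
  "rooted_tree T \<longleftrightarrow> undirected_tree T \<and> (\<exists>!r. r \<in> verts T \<and> in_arcs T r = {})"

definition tree_root :: "('n, 'e) pre_digraph \<Rightarrow> 'n" where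
  "tree_root T = (THE r. r \<in> verts T \<and> in_arcs T r = {})"

text \<open>\<open>parent_arc T n\<close> is the arrow \<open>a\<^sub>n\<close>; it is meaningful only for vertices other than the root.\<close>

definition parent_arc :: "('n, 'e) pre_digraph \<Rightarrow> 'n \<Rightarrow> 'e" where
  "parent_arc T n = (THE a. a \<in> arcs T \<and> head T a = n)"

definition parent :: "('n, 'e) pre_digraph \<Rightarrow> 'n \<Rightarrow> 'n" where
  "parent T n = tail T (parent_arc T n)"

definition rooted_tree_over ::
  "'k::field itself \<Rightarrow> ('q, 'a) pre_digraph \<Rightarrow> ('q, 'a) path set
     \<Rightarrow> ('n, 'e) pre_digraph \<Rightarrow> ('n, 'e, 'q, 'a) qmor \<Rightarrow> bool"
where
  "rooted_tree_over K Q rho T F \<longleftrightarrow> rooted_tree T \<and> bound_morphism K Q rho T F"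

definition pscale :: "'k::field \<Rightarrow> ('n \<Rightarrow>\<^sub>0 'k) \<Rightarrow> ('n \<Rightarrow>\<^sub>0 'k)" where
  "pscale c x = Poly_Mapping.map ((*) c) x"

definition basis_vector :: "'n \<Rightarrow> ('n \<Rightarrow>\<^sub>0 'k::field)" where
  "basis_vector n = Poly_Mapping.single n 1"

lemma lookup_pscale: "Poly_Mapping.lookup (pscale c x) n = c * Poly_Mapping.lookup x n"
  by (simp add: pscale_def Poly_Mapping.map.rep_eq when_def)

lemma vector_space_pscale: "vector_space (pscale :: 'k::field \<Rightarrow> ('n \<Rightarrow>\<^sub>0 'k) \<Rightarrow> _)"
  by unfold_locales (auto intro!: poly_mapping_eqI simp: lookup_pscale lookup_add algebra_simps)

text \<open>The action of an arrow is the linear extension of its action on the basis vectors.\<close>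

definition rooted_tree_module ::
  "('n, 'e) pre_digraph \<Rightarrow> ('n, 'e, 'q, 'a) qmor \<Rightarrow> ('q, 'a, 'n \<Rightarrow>\<^sub>0 'k::field) representation"
where
  "rooted_tree_module T F =
     \<lparr>space = (\<lambda>q. module.span pscale (basis_vector ` {n \<in> verts T. vmap F n = q})),
      act = (\<lambda>g x. \<Sum>n\<in>verts T. pscale (Poly_Mapping.lookup x n)
               (\<Sum>a | a \<in> arcs T \<and> tail T a = n \<and> amap F a = g. basis_vector (head T a)))\<rparr>"


lemma rooted_tree_module_is_representation:
  fixes T :: "('n, 'e) pre_digraph" and F :: "('n, 'e, 'q, 'a) qmor"
  assumes T: "rooted_tree_over TYPE('k::field) Q rho T F"
  shows "is_representation (pscale :: 'k \<Rightarrow> _) Q rho (rooted_tree_module T F)"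
proof -
  interpret P: vector_space "pscale :: 'k \<Rightarrow> ('n \<Rightarrow>\<^sub>0 'k) \<Rightarrow> _" by (rule vector_space_pscale)
  have fin: "fin_digraph T"
    using T by (simp add: rooted_tree_over_def rooted_tree_def undirected_tree_def)
  interpret T: fin_digraph T by (rule fin)
  have F: "quiver_morphism T Q F"
    and bd: "\<And>n p. (n, p) \<in> paths T \<Longrightarrow> \<not> path_in_ideal TYPE('k) Q rho (vmap F n, map (amap F) p)"
    using T by (auto simp: rooted_tree_over_def bound_morphism_def)
  define V :: "('q, 'a, 'n \<Rightarrow>\<^sub>0 'k) representation" where "V = rooted_tree_module T F"
  have sp: "space V q = P.span (basis_vector ` {n \<in> verts T. vmap F n = q})" for q
    by (simp add: V_def rooted_tree_module_def)
  have ac: "act V g x = (\<Sum>n\<in>verts T. pscale (Poly_Mapping.lookup x n)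
               (\<Sum>a | a \<in> arcs T \<and> tail T a = n \<and> amap F a = g. basis_vector (head T a)))" for g x
    by (simp add: V_def rooted_tree_module_def)
  have add: "act V g (x + y) = act V g x + act V g y" for g x y
    by (simp add: ac lookup_add P.scale_left_distrib sum.distrib)
  have scl: "act V g (pscale c x) = pscale c (act V g x)" for g c x
    by (simp add: ac lookup_pscale P.scale_sum_right)
  have zer: "act V g 0 = 0" for g
    by (simp add: ac)
  have bas: "act V g (basis_vector n) =
      (\<Sum>a | a \<in> arcs T \<and> tail T a = n \<and> amap F a = g. basis_vector (head T a))"
    if "n \<in> verts T" for g n
  proof -
    have "act V g (basis_vector n) = (\<Sum>k\<in>verts T. if k = n then
       (\<Sum>a | a \<in> arcs T \<and> tail T a = n \<and> amap F a = g. basis_vector (head T a)) else 0)"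
      unfolding ac by (rule sum.cong) (auto simp: basis_vector_def lookup_single when_def)
    then show ?thesis using that by simp
  qed
  have img: "act V g x \<in> space V (head Q g)" if "x \<in> space V (tail Q g)" for g x
    using that unfolding sp
  proof (induction rule: P.span_induct_alt)
    case base
    then show ?case by (simp add: zer P.span_zero)
  next
    case (step c x y)
    from step(1) obtain n where n: "x = basis_vector n" "n \<in> verts T" "vmap F n = tail Q g"
      by auto
    have "act V g x \<in> P.span (basis_vector ` {n \<in> verts T. vmap F n = head Q g})"
      unfolding n(1) bas[OF n(2)] using F
      by (intro P.span_sum) (auto simp: quiver_morphism_def intro!: P.span_base imageI)
    then show ?case using step by (simp add: add scl P.span_add P.span_scale)
  qed
  have fadd: "fold (act V) p (x + y) = fold (act V) p x + fold (act V) p y" for p x y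
    by (induction p arbitrary: x y) (simp_all add: add)
  have fscl: "fold (act V) p (pscale c x) = pscale c (fold (act V) p x)" for p c x
    by (induction p arbitrary: x) (simp_all add: scl)
  have fzer: "fold (act V) p 0 = 0" for p
    by (induction p) (simp_all add: zer)
  have fsum: "fold (act V) p (sum f A) = (\<Sum>a\<in>A. fold (act V) p (f a))" for p A and f :: "'e \<Rightarrow> _"
    by (induction A rule: infinite_finite_induct) (simp_all add: fadd fzer)
  have lift: "\<exists>ps. (n, ps) \<in> paths T \<and> map (amap F) ps = p"
    if "fold (act V) p (basis_vector n) \<noteq> 0" "n \<in> verts T" for p n
    using that
  proof (induction p arbitrary: n)
    case Nil
    then show ?case by (auto simp: paths_def T.awalk_def)
  next
    case (Cons g p)
    from Cons.prems obtain a where a: "a \<in> arcs T" "tail T a = n" "amap F a = g"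
      and "fold (act V) p (basis_vector (head T a)) \<noteq> 0"
      by (auto simp: bas fsum elim!: sum.not_neutral_contains_not_neutral)
    with Cons.IH[of "head T a"] obtain ps where
      "(head T a, ps) \<in> paths T" "map (amap F) ps = p" by auto
    with a show ?case
      by (intro exI[of _ "a # ps"]) (auto simp: paths_def T.awalk_Cons_iff)
  qed
  have rel: "fold (act V) p x = 0" if r: "(u, p) \<in> rho" and x: "x \<in> space V u" for u p x
    using x unfolding sp
  proof (induction rule: P.span_induct_alt)
    case base
    then show ?case by (simp add: fzer)
  next
    case (step c x y)
    from step(1) obtain n where n: "x = basis_vector n" "n \<in> verts T" "vmap F n = u" by auto
    have "path_in_ideal TYPE('k) Q rho (u, p)"
      unfolding path_in_ideal_def using r by (rule path_ideal.generator)
    then have "fold (act V) p x = 0"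
      using lift[of p n] bd n by auto
    then show ?case using step by (simp add: fadd fscl)
  qed
  show ?thesis
    using vector_space_pscale img add scl rel
    by (auto simp: is_representation_def V_def[symmetric] sp)
qed


section \<open>Generalized graph maps\<close>

definition pullback_network ::
  "('n, 'e) pre_digraph \<Rightarrow> ('n, 'e, 'q, 'a) qmor \<Rightarrow> ('m, 'f) pre_digraph \<Rightarrow> ('m, 'f, 'q, 'a) qmor
     \<Rightarrow> ('n \<times> 'm, 'e \<times> 'f) network"
where
  "pullback_network T1 F1 T2 F2 =
    (let V = {(n, m). n \<in> verts T1 \<and> m \<in> verts T2 \<and> vmap F1 n = vmap F2 m} in
     \<lparr>quiver =
        \<lparr>verts = V,
         arcs = {(a, b). a \<in> arcs T1 \<and> b \<in> arcs T2 \<and> amap F1 a = amap F2 b},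
         tail = (\<lambda>(a, b). (tail T1 a, tail T2 b)),
         head = (\<lambda>(a, b). (head T1 a, head T2 b))\<rparr>,
      edges = {{(n, m), (n', m)} | n n' m.
         (n, m) \<in> V \<and> (n', m) \<in> V \<and> n \<noteq> tree_root T1 \<and> n' \<noteq> tree_root T1 \<and>
         n \<noteq> n' \<and> parent T1 n = parent T1 n' \<and>
         amap F1 (parent_arc T1 n) = amap F1 (parent_arc T1 n')}\<rparr>)"

definition covering_network ::
  "('n, 'e) pre_digraph \<Rightarrow> ('n, 'e, 'q, 'a) qmor \<Rightarrow> ('m, 'f) pre_digraph \<Rightarrow> ('m, 'f, 'q, 'a) qmor
     \<Rightarrow> ('n \<times> 'm \<times> int, 'e \<times> 'f \<times> int) network"
where
  "covering_network T1 F1 T2 F2 =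
    (let N = pullback_network T1 F1 T2 F2 in
     \<lparr>quiver =
        \<lparr>verts = {(n, m, i). (n, m) \<in> verts (quiver N) \<and> i \<in> {-1, 1}},
         arcs = {(a, b, i). (a, b) \<in> arcs (quiver N) \<and> i \<in> {-1, 1}},
         tail = (\<lambda>(a, b, i). case tail (quiver N) (a, b) of (n, m) \<Rightarrow> (n, m, i)),
         head = (\<lambda>(a, b, i). case head (quiver N) (a, b) of (n, m) \<Rightarrow> (n, m, i))\<rparr>,
      edges = {{(n, m, i), (n', m, -i)} | n n' m i. {(n, m), (n', m)} \<in> edges N \<and> i \<in> {-1, 1}}\<rparr>)"

lemma covering_network_is_network:
  assumes "wf_digraph T1" "wf_digraph T2" "quiver_morphism T1 Q F1" "quiver_morphism T2 Q F2"
  shows "is_network (pullback_network T1 F1 T2 F2)" "is_network (covering_network T1 F1 T2 F2)"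
proof -
  have e: "vmap F1 (tail T1 a) = vmap F2 (tail T2 b)" "vmap F1 (head T1 a) = vmap F2 (head T2 b)"
    if "a \<in> arcs T1" "b \<in> arcs T2" "amap F1 a = amap F2 b" for a b
    using assms(3,4) that unfolding quiver_morphism_def by metis+
  show p: "is_network (pullback_network T1 F1 T2 F2)"
    unfolding is_network_def
  proof
    show "wf_digraph (quiver (pullback_network T1 F1 T2 F2))"
      using assms(1,2)
      by (auto simp: pullback_network_def wf_digraph_def e Let_def)
    show "\<forall>e\<in>edges (pullback_network T1 F1 T2 F2).
       \<exists>u\<in>verts (quiver (pullback_network T1 F1 T2 F2)).
         \<exists>v\<in>verts (quiver (pullback_network T1 F1 T2 F2)). u \<noteq> v \<and> e = {u, v}"
    proof
      fix e assume "e \<in> edges (pullback_network T1 F1 T2 F2)"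
      then obtain n n' m where h: "e = {(n, m), (n', m)}" "n \<noteq> n'"
        "(n, m) \<in> verts (quiver (pullback_network T1 F1 T2 F2))"
        "(n', m) \<in> verts (quiver (pullback_network T1 F1 T2 F2))"
        unfolding pullback_network_def Let_def by fastforce
      then show "\<exists>u\<in>verts (quiver (pullback_network T1 F1 T2 F2)).
         \<exists>v\<in>verts (quiver (pullback_network T1 F1 T2 F2)). u \<noteq> v \<and> e = {u, v}"
        by (intro bexI[of _ "(n, m)"] bexI[of _ "(n', m)"]) simp_all
    qed
  qed
  show "is_network (covering_network T1 F1 T2 F2)"
    unfolding is_network_def
  proof
    show "wf_digraph (quiver (covering_network T1 F1 T2 F2))"
      using assms(1,2)
      by (auto simp: covering_network_def pullback_network_def wf_digraph_def e Let_def)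
    show "\<forall>e\<in>edges (covering_network T1 F1 T2 F2).
       \<exists>u\<in>verts (quiver (covering_network T1 F1 T2 F2)).
         \<exists>v\<in>verts (quiver (covering_network T1 F1 T2 F2)). u \<noteq> v \<and> e = {u, v}"
    proof
      fix e assume "e \<in> edges (covering_network T1 F1 T2 F2)"
      then obtain n n' m i where h: "e = {(n, m, i), (n', m, -i)}" "i \<in> {-1, 1}"
        "{(n, m), (n', m)} \<in> edges (pullback_network T1 F1 T2 F2)"
        by (auto simp: covering_network_def Let_def)
      from p h(3) have "(n, m) \<in> verts (quiver (pullback_network T1 F1 T2 F2))"
        "(n', m) \<in> verts (quiver (pullback_network T1 F1 T2 F2))"
        unfolding is_network_def by (metis doubleton_eq_iff)+
      with h(1,2) show "\<exists>u\<in>verts (quiver (covering_network T1 F1 T2 F2)).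
         \<exists>v\<in>verts (quiver (covering_network T1 F1 T2 F2)). u \<noteq> v \<and> e = {u, v}"
        by (intro bexI[of _ "(n, m, i)"] bexI[of _ "(n', m, -i)"])
          (auto simp: covering_network_def Let_def)
    qed
  qed
qed

definition forget_sign :: "'x \<times> 'y \<times> int \<Rightarrow> 'x \<times> 'y" where
  "forget_sign = (\<lambda>(x, y, i). (x, y))"

fun forget_sign_link :: "('n \<times> 'm \<times> int, 'e \<times> 'f \<times> int) link \<Rightarrow> ('n \<times> 'm, 'e \<times> 'f) link" where
  "forget_sign_link (Arrow a) = Arrow (forget_sign a)"
| "forget_sign_link (Inverse a) = Inverse (forget_sign a)"
| "forget_sign_link (Edge e) = Edge (forget_sign ` e)"

definition forget_sign_walk ::
  "('n \<times> 'm \<times> int, 'e \<times> 'f \<times> int) walk \<Rightarrow> ('n \<times> 'm, 'e \<times> 'f) walk"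
where
  "forget_sign_walk t = (forget_sign (fst t), map (map_prod forget_sign_link forget_sign) (snd t))"

definition triangle :: "('v, 'a) network \<Rightarrow> 'v set \<Rightarrow> bool" where
  "triangle N S \<longleftrightarrow> S \<subseteq> verts (quiver N) \<and> card S = 3 \<and>
     card (arcs (quiver (induced_subnetwork N S))) + card (edges (induced_subnetwork N S)) = 3"

definition triangle_traversals ::
  "('n, 'e) pre_digraph \<Rightarrow> ('n, 'e, 'q, 'a) qmor \<Rightarrow> ('m, 'f) pre_digraph \<Rightarrow> ('m, 'f, 'q, 'a) qmor
     \<Rightarrow> ('n \<times> 'm, 'e \<times> 'f) walk set"
where
  "triangle_traversals T1 F1 T2 F2 =
    {t \<in> traversals (pullback_network T1 F1 T2 F2).
       length (snd t) = 2 \<and> triangle (pullback_network T1 F1 T2 F2) (set (walk_verts t))}"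

definition covering_triangle_traversals ::
  "('n, 'e) pre_digraph \<Rightarrow> ('n, 'e, 'q, 'a) qmor \<Rightarrow> ('m, 'f) pre_digraph \<Rightarrow> ('m, 'f, 'q, 'a) qmor
     \<Rightarrow> ('n \<times> 'm \<times> int, 'e \<times> 'f \<times> int) walk set"
where
  "covering_triangle_traversals T1 F1 T2 F2 =
    {t \<in> traversals (covering_network T1 F1 T2 F2).
       forget_sign_walk t \<in> triangle_traversals T1 F1 T2 F2}"

definition involution_free :: "('n \<times> 'm \<times> int, 'e \<times> 'f \<times> int) network \<Rightarrow> bool" where
  "involution_free M \<longleftrightarrow>
     (\<forall>n m j. (n, m, j) \<in> verts (quiver M) \<longrightarrow> (n, m, -j) \<notin> verts (quiver M))"

definition complete_network ::
  "('n, 'e) pre_digraph \<Rightarrow> ('n, 'e, 'q, 'a) qmor \<Rightarrow> ('m, 'f) pre_digraph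
     \<Rightarrow> ('n \<times> 'm \<times> int, 'e \<times> 'f \<times> int) network \<Rightarrow> bool"
where
  "complete_network T1 F1 T2 M \<longleftrightarrow>
     (\<forall>(n, m, j) \<in> verts (quiver M).
        (\<forall>a\<in>arcs T1. head T1 a = n \<longrightarrow>
           (\<exists>b\<in>arcs T2. head T2 b = m \<and> (a, b, j) \<in> arcs (quiver M)) \<or>
           (\<exists>a'\<in>arcs T1. tail T1 a' = tail T1 a \<and> amap F1 a = amap F1 a' \<and>
              (head T1 a', m, -j) \<in> verts (quiver M) \<and>
              {(n, m, j), (head T1 a', m, -j)} \<in> edges M)) \<and>
        (\<forall>b\<in>arcs T2. tail T2 b = m \<longrightarrow>
           (\<exists>a\<in>arcs T1. tail T1 a = n \<and> (a, b, j) \<in> arcs (quiver M))))"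

definition generalized_graph_map ::
  "('n, 'e) pre_digraph \<Rightarrow> ('n, 'e, 'q, 'a) qmor \<Rightarrow> ('m, 'f) pre_digraph \<Rightarrow> ('m, 'f, 'q, 'a) qmor
     \<Rightarrow> ('n \<times> 'm \<times> int, 'e \<times> 'f \<times> int) network \<Rightarrow> bool"
where
  "generalized_graph_map T1 F1 T2 F2 M \<longleftrightarrow>
     subnetwork M (covering_network T1 F1 T2 F2) \<and>
     verts (quiver M) \<noteq> {} \<and>
     complete_network T1 F1 T2 M \<and>
     network_connected M \<and>
     traversals M \<inter> covering_triangle_traversals T1 F1 T2 F2 = {} \<and>
     involution_free M"

end

theory Submission
  imports Defs
begin

text \<open>
  All three conditions are equivalent to the absence of distinct siblings \<open>n\<close>, \<open>m\<close>, reached by arrows with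
  equal labels, such that the subtree below \<open>m\<close> maps over \<open>Q\<close> to the one below \<open>n\<close>. Such a map folds \<open>T\<close>
  onto a proper subtree, and conversely the topmost vertex moved by an idempotent and its image are
  such siblings. Composition with the idempotent \<open>\<iota>\<close> on coordinates is a nontrivial idempotent
  endomorphism of the module. The graph of \<open>\<iota>\<close> below \<open>m\<close>, on the sheet \<open>1\<close>, and the diagonal below \<open>m\<close>, on the
  sheet \<open>-1\<close>, joined by the edge over \<open>{(n, m), (m, m)}\<close>, form a generalized graph map. Conversely,
  the lifting property in the completeness of a generalized graph map through \<open>(n, m)\<close> yields the
  map of subtrees, and so does a nonzero \<open>(n, m)\<close> entry of an endomorphism.

  In the absence of such siblings, the matrix of an endomorphism has a constant diagonal, and its
  nonzero off-diagonal entries form an acyclic relation, since taking parents would move a cycle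
  towards the root. Hence the difference from a scalar is nilpotent, and only \<open>0\<close> and the identity
  are idempotent.
\<close>

section \<open>Rooted trees\<close>

lemma walk_from_start: "walk_from N u xs \<Longrightarrow> u \<in> verts (quiver N)"
  by (cases xs) auto

lemma walk_from_append:
  "walk_from N u (xs @ ys) \<longleftrightarrow> walk_from N u xs \<and> walk_from N (last (u # map snd xs)) ys"
  by (induction xs arbitrary: u) (auto dest: walk_from_start)

lemma walk_from_verts: "walk_from N u xs \<Longrightarrow> set (walk_verts (u, xs)) \<subseteq> verts (quiver N)"
proof (induction xs arbitrary: u)
  case Nil
  then show ?case by (simp add: walk_verts_def)
next
  case (Cons x xs)
  obtain l v where x: "x = (l, v)" by (cases x)
  with Cons.prems have u: "u \<in> verts (quiver N)" and v: "walk_from N v xs" by auto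
  show ?case using u Cons.IH[OF v] by (simp add: x walk_verts_def)
qed

text \<open>By induction the vertices after the start are distinct. Were the start to recur among
  them, the initial segment up to that recurrence would be an undirected cycle.\<close>

lemma acyclic_traversal_distinct:
  assumes "\<nexists>t. undirected_cycle T t" and "(u, xs) \<in> traversals \<lparr>quiver = T, edges = {}\<rparr>"
  shows "distinct (walk_verts (u, xs))"
  using assms(2)
proof (induction xs arbitrary: u)
  case Nil
  then show ?case by (simp add: walk_verts_def)
next
  case (Cons x xs)
  obtain l v where x: "x = (l, v)" by (cases x)
  have "(v, xs) \<in> traversals \<lparr>quiver = T, edges = {}\<rparr>"
    using Cons.prems x by (cases xs) (auto simp: traversals_def)
  then have d: "distinct (walk_verts (v, xs))" by (rule Cons.IH)
  have "u \<notin> set (walk_verts (v, xs))"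
  proof
    assume "u \<in> set (walk_verts (v, xs))"
    then have "u \<in> snd ` set (x # xs)" by (auto simp: x walk_verts_def)
    then obtain l' where "(l', u) \<in> set (x # xs)" by force
    then obtain ys zs where "x # xs = ys @ (l', u) # zs" by (meson split_list)
    then have s: "x # xs = (ys @ [(l', u)]) @ zs" by simp
    have "distinct (map snd (x # xs))" using d by (simp add: x walk_verts_def)
    moreover have "(u, ys @ [(l', u)]) \<in> traversals \<lparr>quiver = T, edges = {}\<rparr>"
      using Cons.prems unfolding s traversals_def
      by (simp add: walk_from_append successively_append_iff del: append_assoc)
    ultimately have "undirected_cycle T (u, ys @ [(l', u)])"
      unfolding s by (simp add: undirected_cycle_def walk_verts_def)
    then show False using assms(1) by blast
  qed
  then show ?case using d by (simp add: x walk_verts_def)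
qed

section \<open>Incoming arrows, depth and subtrees of a rooted tree\<close>

locale rooted_tree_digraph = fin_digraph T for T :: "('n, 'e) pre_digraph" +
  assumes rooted: "rooted_tree T"
begin

abbreviation "network_of_tree \<equiv> \<lparr>quiver = T, edges = {}\<rparr> :: ('n, 'e) network"

lemma ex1_root: "\<exists>!r. r \<in> verts T \<and> in_arcs T r = {}"
  using rooted by (simp add: rooted_tree_def)

lemma root_in_verts: "tree_root T \<in> verts T" and in_arcs_root: "in_arcs T (tree_root T) = {}"
  unfolding tree_root_def using theI'[OF ex1_root] by blast+

lemma head_ne_root: "a \<in> arcs T \<Longrightarrow> head T a \<noteq> tree_root T"
  using in_arcs_root by (auto simp: in_arcs_def)

lemma ex_in_arc:
  assumes "n \<in> verts T" and "n \<noteq> tree_root T"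
  obtains a where "a \<in> arcs T" and "head T a = n"
proof -
  have "in_arcs T n \<noteq> {}" using assms ex1_root root_in_verts in_arcs_root by metis
  then show ?thesis using that by (auto simp: in_arcs_def)
qed

lemma traversal_distinct:
  "(u, xs) \<in> traversals network_of_tree \<Longrightarrow> distinct (walk_verts (u, xs))"
  using acyclic_traversal_distinct[of T u xs] rooted by (simp add: rooted_tree_def undirected_tree_def)

text \<open>The bound makes a longest reduced walk of a given shape exist, and it excludes an
  endless ascent through parents.\<close>

lemma traversal_length:
  assumes "(u, xs) \<in> traversals network_of_tree"
  shows "length xs < card (verts T)"
proof -
  have "set (walk_verts (u, xs)) \<subseteq> verts T"
    using assms walk_from_verts[of network_of_tree] by (auto simp: traversals_def)
  then have "card (set (walk_verts (u, xs))) \<le> card (verts T)"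
    by (intro card_mono) auto
  then show ?thesis
    using distinct_card[OF traversal_distinct[OF assms]] by (simp add: walk_verts_def)
qed

text \<open>A reduced walk that enters \<open>n\<close> along \<open>a\<close> and leaves it backwards along another arrow
  can be prolonged at both ends up to the root, where it closes.\<close>

lemma head_inj:
  assumes "a \<in> arcs T" and "b \<in> arcs T" and "head T a = head T b"
  shows "a = b"
proof (rule ccontr)
  assume ne: "a \<noteq> b"
  \<comment> \<open>This shape makes prolongation free of cancellation: an arrow put in front meets
    an arrow, and an inverse appended meets an inverse.\<close>
  define S where "S t \<longleftrightarrow> t \<in> traversals network_of_tree \<and> snd t \<noteq> [] \<and>
    (\<exists>c. fst (hd (snd t)) = Arrow c) \<and> (\<exists>c. fst (last (snd t)) = Inverse c)" for t
  have "S (tail T a, [(Arrow a, head T a), (Inverse b, tail T b)])"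
    using assms ne by (simp add: S_def traversals_def)
  moreover have "\<forall>t. S t \<longrightarrow> length (snd t) < card (verts T)"
    using traversal_length by (auto simp: S_def)
  ultimately obtain t where t: "S t" and mx: "\<And>t'. S t' \<Longrightarrow> length (snd t') \<le> length (snd t)"
    using ex_has_greatest_nat[of S _ "\<lambda>t. length (snd t)"] by blast
  obtain u xs where u: "t = (u, xs)" by (cases t)
  have tr: "walk_from network_of_tree u xs"
    "successively (\<lambda>l l'. l' \<noteq> link_inverse l) (map fst xs)" "xs \<noteq> []"
    using t by (auto simp: S_def u traversals_def)
  obtain c d where cd: "fst (hd xs) = Arrow c" "fst (last xs) = Inverse d"
    using t by (auto simp: S_def u)
  have "u = tree_root T"
  proof (rule ccontr)
    assume "u \<noteq> tree_root T"
    then obtain e where e: "e \<in> arcs T" "head T e = u"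
      using ex_in_arc walk_from_start[OF tr(1)] by auto
    have "S (tail T e, (Arrow e, u) # xs)"
      using tr cd e by (cases xs) (auto simp: S_def traversals_def)
    from mx[OF this] show False by (simp add: u)
  qed
  moreover have "last (map snd xs) = tree_root T"
  proof (rule ccontr)
    assume "last (map snd xs) \<noteq> tree_root T"
    moreover have l: "last (map snd xs) \<in> verts T"
      using walk_from_verts[OF tr(1)] last_in_set[of "map snd xs"] tr(3)
      by (auto simp: walk_verts_def)
    ultimately obtain e where e: "e \<in> arcs T" "head T e = last (map snd xs)"
      using ex_in_arc by blast
    have "S (u, xs @ [(Inverse e, tail T e)])"
      using tr cd e l
      by (auto simp: S_def traversals_def walk_from_append successively_append_iff last_map)
    from mx[OF this] show False by (simp add: u)
  qed
  ultimately have "u \<in> set (map snd xs)"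
    using tr(3) last_in_set[of "map snd xs"] by simp
  then show False
    using traversal_distinct[of u xs] tr by (auto simp: walk_verts_def traversals_def)
qed

lemma parent_arc_head: "a \<in> arcs T \<Longrightarrow> parent_arc T (head T a) = a"
  unfolding parent_arc_def by (rule the_equality) (auto dest: head_inj)

lemma parent_head: "a \<in> arcs T \<Longrightarrow> parent T (head T a) = tail T a"
  by (simp add: parent_def parent_arc_head)

lemma parent_arc:
  assumes "n \<in> verts T" and "n \<noteq> tree_root T"
  shows "parent_arc T n \<in> arcs T" and "head T (parent_arc T n) = n"
  using ex_in_arc[OF assms] parent_arc_head by metis+

text \<open>Otherwise iterating \<open>parent\<close> would give walks of every length. They consist
  of inverse arrows only, so nothing cancels and they are reduced, against the bound on the
  length.\<close>

lemma reaches_root: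
  assumes "n \<in> verts T"
  shows "\<exists>k. (parent T ^^ k) n = tree_root T"
proof (rule ccontr)
  assume no: "\<nexists>k. (parent T ^^ k) n = tree_root T"
  have "\<exists>xs. (n, xs) \<in> traversals network_of_tree \<and> length xs = k \<and>
      last (n # map snd xs) = (parent T ^^ k) n \<and> (\<forall>l\<in>fst ` set xs. \<exists>a. l = Inverse a)" for k
  proof (induction k)
    case 0
    then show ?case using assms by (intro exI[of _ "[]"]) (simp add: traversals_def)
  next
    case (Suc k)
    then obtain xs where xs: "(n, xs) \<in> traversals network_of_tree" "length xs = k"
      "last (n # map snd xs) = (parent T ^^ k) n" "\<forall>l\<in>fst ` set xs. \<exists>a. l = Inverse a"
      by blast
    let ?v = "(parent T ^^ k) n"
    have "set (n # map snd xs) \<subseteq> verts T"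
      using xs(1) walk_from_verts[of network_of_tree n xs] by (auto simp: traversals_def walk_verts_def)
    then have v: "?v \<in> verts T" using xs(3) last_in_set[of "n # map snd xs"] by auto
    define a where "a = parent_arc T ?v"
    have a: "a \<in> arcs T" "head T a = ?v" using parent_arc[OF v] no by (auto simp: a_def)
    have "successively (\<lambda>l l'. l' \<noteq> link_inverse l) (map fst (xs @ [(Inverse a, parent T ?v)]))"
    proof -
      have "\<exists>b. fst (last xs) = Inverse b" if "xs \<noteq> []"
        using xs(4) last_in_set[OF that] by blast
      then show ?thesis
        using xs(1) by (auto simp: successively_append_iff traversals_def last_map)
    qed
    moreover have "walk_from network_of_tree n (xs @ [(Inverse a, parent T ?v)])"
      using xs(1,3) a v parent_head[OF a(1)]
      by (auto simp: walk_from_append traversals_def simp del: last.simps)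
    ultimately show ?case using xs
      by (intro exI[of _ "xs @ [(Inverse a, parent T ?v)]"]) (auto simp: traversals_def)
  qed
  from this[of "card (verts T)"] obtain xs
    where "(n, xs) \<in> traversals network_of_tree" "length xs = card (verts T)" by blast
  then show False using traversal_length[of n xs] by simp
qed

definition depth :: "'n \<Rightarrow> nat" where
  "depth n = (LEAST k. (parent T ^^ k) n = tree_root T)"

lemma depth_head:
  assumes "a \<in> arcs T"
  shows "depth (head T a) = Suc (depth (tail T a))"
proof -
  let ?P = "\<lambda>k. (parent T ^^ k) (head T a) = tree_root T"
  have "\<exists>k. ?P k" using assms by (intro reaches_root head_in_verts)
  then obtain k where k: "?P k" ..
  have 0: "\<not> ?P 0" using head_ne_root[OF assms] by simp
  have "depth (head T a) = Suc (LEAST k. ?P (Suc k))"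
    unfolding depth_def by (rule Least_Suc[of ?P, OF k 0])
  moreover have "(parent T ^^ Suc k) (head T a) = (parent T ^^ k) (tail T a)" for k
    by (simp only: funpow_Suc_right o_apply parent_head[OF assms])
  ultimately show ?thesis
    by (simp only: depth_def)
qed

lemma tree_induct [consumes 1, case_names root arc]:
  assumes "n \<in> verts T" and "P (tree_root T)" and "\<And>a. a \<in> arcs T \<Longrightarrow> P (tail T a) \<Longrightarrow> P (head T a)"
  shows "P n"
  using assms(1)
proof (induction "depth n" arbitrary: n rule: less_induct)
  case less
  show ?case
  proof (cases "n = tree_root T")
    case True
    then show ?thesis using assms(2) by simp
  next
    case False
    then obtain a where a: "a \<in> arcs T" "head T a = n" using ex_in_arc less.prems by blast
    then have "P (tail T a)" using less.hyps[of "tail T a"] depth_head[OF a(1)] by simp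
    then show ?thesis using assms(3)[OF a(1)] a(2) by simp
  qed
qed

inductive_set subtree :: "'n \<Rightarrow> 'n set" for m where
  base: "m \<in> verts T \<Longrightarrow> m \<in> subtree m"
| step: "a \<in> arcs T \<Longrightarrow> tail T a \<in> subtree m \<Longrightarrow> head T a \<in> subtree m"

lemma subtree_verts: "k \<in> subtree m \<Longrightarrow> k \<in> verts T"
  by (induction rule: subtree.induct) auto

lemma subtree_tail:
  assumes "a \<in> arcs T" and "head T a \<in> subtree m" and "head T a \<noteq> m"
  shows "tail T a \<in> subtree m"
  using assms(2)
proof cases
  case base
  then show ?thesis using assms(3) by simp
next
  case (step b)
  then show ?thesis using head_inj[OF assms(1) step(2) step(1)] by simp
qed

lemma subtree_depth: "k \<in> subtree m \<Longrightarrow> depth m \<le> depth k"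
  by (induction rule: subtree.induct) (simp_all add: depth_head)

text \<open>Since incoming arrows are unique, a common vertex can be replaced by its parent until
  one of the two heads is reached. Then the common parent of the heads would lie in the subtree of
  the other head, which is deeper.\<close>

lemma subtree_siblings_disjoint:
  assumes "a \<in> arcs T" and "b \<in> arcs T" and "tail T a = tail T b" and "a \<noteq> b"
    and "k \<in> subtree (head T a)"
  shows "k \<notin> subtree (head T b)"
  using assms(5)
proof (induction rule: subtree.induct)
  case base
  show ?case
  proof
    assume a: "head T a \<in> subtree (head T b)"
    have "head T a \<noteq> head T b" using assms(1,2,4) head_inj by blast
    then have "tail T a \<in> subtree (head T b)" using subtree_tail[OF assms(1) a] by blast
    then show False using subtree_depth depth_head[OF assms(2)] assms(3) by fastforce
  qed
next
  case (step c)
  show ?case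
  proof
    assume c: "head T c \<in> subtree (head T b)"
    show False
    proof (cases "head T c = head T b")
      case True
      then have "c = b" using step assms by (auto dest: head_inj)
      then show False
        using subtree_depth[OF step(2)] depth_head[OF assms(1)] assms(3) by simp
    next
      case False
      then show False using subtree_tail[OF step(1) c] step by blast
    qed
  qed
qed

end

section \<open>Retractions and simulations\<close>

locale labelled_tree = rooted_tree_digraph T for T :: "('n, 'e) pre_digraph" +
  fixes Q :: "('q, 'a) pre_digraph" and F :: "('n, 'e, 'q, 'a) qmor"
  assumes wf_quiver: "wf_digraph Q"
    and morphism: "quiver_morphism T Q F"
begin

lemma vmap_head: "a \<in> arcs T \<Longrightarrow> head Q (amap F a) = vmap F (head T a)"
  and vmap_tail: "a \<in> arcs T \<Longrightarrow> tail Q (amap F a) = vmap F (tail T a)"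
  and amap_in_arcs: "a \<in> arcs T \<Longrightarrow> amap F a \<in> arcs Q"
  and vmap_in_verts: "n \<in> verts T \<Longrightarrow> vmap F n \<in> verts Q"
  using morphism by (auto simp: quiver_morphism_def)

text \<open>This encodes a label-preserving map from the subtree below \<open>m\<close> to the one
  below \<open>n\<close> that sends \<open>m\<close> to \<open>n\<close>. The coinductive form
  allows a proof from an invariant set of pairs, such as the nonzero entries of a matrix, without
  building the map.\<close>

coinductive simulates :: "'n \<Rightarrow> 'n \<Rightarrow> bool" where
  "(\<forall>b\<in>arcs T. tail T b = m \<longrightarrow>
     (\<exists>a\<in>arcs T. tail T a = n \<and> amap F a = amap F b \<and> simulates (head T a) (head T b))) \<Longrightarrow>
   simulates n m"

lemma simulatesE:
  assumes "simulates n m" and "b \<in> arcs T" and "tail T b = m"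
  obtains a where "a \<in> arcs T" "tail T a = n" "amap F a = amap F b" "simulates (head T a) (head T b)"
  using assms by (auto elim: simulates.cases)

lemma simulates_refl: "simulates n n"
  by (coinduction arbitrary: n) blast

lemma simulates_trans:
  assumes "simulates n k" and "simulates k m"
  shows "simulates n m"
proof -
  have "\<exists>k. simulates n k \<and> simulates k m" using assms by blast
  then show ?thesis
  proof (coinduction arbitrary: n m rule: simulates.coinduct)
    case simulates
    then obtain k where k: "simulates n k" "simulates k m" by blast
    have "\<exists>a\<in>arcs T. tail T a = n \<and> amap F a = amap F b \<and>
       (\<exists>k. simulates (head T a) k \<and> simulates k (head T b))"
      if b: "b \<in> arcs T" "tail T b = m" for b
    proof -
      obtain c where c: "c \<in> arcs T" "tail T c = k" "amap F c = amap F b" "simulates (head T c) (head T b)"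
        using simulatesE[OF k(2) b] .
      obtain a where "a \<in> arcs T" "tail T a = n" "amap F a = amap F c" "simulates (head T a) (head T c)"
        using simulatesE[OF k(1) c(1,2)] .
      then show ?thesis using c by (intro bexI[of _ a]) auto
    qed
    then show ?case by blast
  qed
qed

text \<open>These are the pairs to whose absence all three conditions reduce; the subtree at
  \<open>a\<close> receives the one at \<open>b\<close>.\<close>

definition simulating_siblings :: "'e \<Rightarrow> 'e \<Rightarrow> bool" where
  "simulating_siblings a b \<longleftrightarrow> a \<in> arcs T \<and> b \<in> arcs T \<and> a \<noteq> b \<and> tail T a = tail T b \<and>
     amap F a = amap F b \<and> simulates (head T a) (head T b)"

definition retraction :: "('n, 'e, 'n, 'e) qmor \<Rightarrow> bool" where
  "retraction i \<longleftrightarrow> quiver_morphism T T i \<and> qmor_eq T (qmor_comp i i) i \<and>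
     \<not> qmor_eq T i qmor_id \<and> qmor_eq T (qmor_comp F i) F"

text \<open>The map is chosen from the top down: once the tail of an arrow has its image, simulation
  offers an equally labelled arrow there, and its head again simulates the head of the given arrow,
  so the choice can go on.\<close>

lemma simulation_map:
  assumes nm: "simulates n m"
  obtains \<phi> where "\<phi> m = n"
    and "\<And>c. c \<in> arcs T \<Longrightarrow> tail T c \<in> subtree m \<Longrightarrow>
      \<exists>d\<in>arcs T. tail T d = \<phi> (tail T c) \<and> head T d = \<phi> (head T c) \<and> amap F d = amap F c"
proof -
  \<comment> \<open>\<open>ok y x d\<close> says that \<open>d\<close> may serve as the image of the
    arrow into \<open>x\<close> when the parent of \<open>x\<close> goes to
    \<open>y\<close>.\<close>
  define ok where "ok y x d \<longleftrightarrow> d \<in> arcs T \<and> tail T d = y \<and> amap F d = amap F (parent_arc T x) \<and>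
    simulates (head T d) x" for y x d
  \<comment> \<open>\<open>g k x\<close> is the intended image of a vertex \<open>x\<close> lying
    \<open>k\<close> levels below \<open>m\<close>; recursion on the level replaces recursion along
    parents.\<close>
  define g where "g = rec_nat (\<lambda>_. n) (\<lambda>_ r x. head T (SOME d. ok (r (parent T x)) x d))"
  define \<phi> where "\<phi> x = g (depth x - depth m) x" for x
  have phi_m: "\<phi> m = n" by (simp add: \<phi>_def g_def)
  have phi_head: "\<phi> (head T c) = head T (SOME d. ok (\<phi> (tail T c)) (head T c) d)"
    if "c \<in> arcs T" "tail T c \<in> subtree m" for c
  proof -
    have "depth (head T c) - depth m = Suc (depth (tail T c) - depth m)"
      using depth_head[OF that(1)] subtree_depth[OF that(2)] by simp
    then show ?thesis by (simp add: \<phi>_def g_def parent_head that)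
  qed
  have ex: "\<exists>d. ok (\<phi> (tail T c)) (head T c) d"
    if "c \<in> arcs T" "simulates (\<phi> (tail T c)) (tail T c)" for c
    using simulatesE[OF that(2,1) refl] unfolding ok_def parent_arc_head[OF that(1)] by metis
  have sim: "simulates (\<phi> x) x" if "x \<in> subtree m" for x
    using that
  proof (induction rule: subtree.induct)
    case base
    then show ?case using nm phi_m by simp
  next
    case (step c)
    then show ?case
      using someI_ex[OF ex[OF step(1,3)]] phi_head[OF step(1,2)] by (simp add: ok_def)
  qed
  show ?thesis
  proof
    fix c assume c: "c \<in> arcs T" "tail T c \<in> subtree m"
    show "\<exists>d\<in>arcs T. tail T d = \<phi> (tail T c) \<and> head T d = \<phi> (head T c) \<and> amap F d = amap F c"
      using someI_ex[OF ex[OF c(1) sim[OF c(2)]]] phi_head[OF c] parent_arc_head[OF c(1)]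
      by (intro bexI[of _ "SOME d. ok (\<phi> (tail T c)) (head T c) d"]) (simp_all add: ok_def)
  qed (rule phi_m)
qed

text \<open>The subtree at \<open>b\<close> is folded into the one at \<open>a\<close>, and the rest
  of the tree is fixed. The two subtrees are disjoint, so the folded image is fixed, which gives
  idempotence.\<close>

lemma ex_retraction:
  assumes "simulating_siblings a b"
  shows "\<exists>i. retraction i"
proof -
  have ab: "a \<in> arcs T" "b \<in> arcs T" "a \<noteq> b" "tail T a = tail T b" "amap F a = amap F b"
    and nm: "simulates (head T a) (head T b)"
    using assms by (auto simp: simulating_siblings_def)
  let ?n = "head T a" and ?m = "head T b"
  obtain \<phi> where phi_m: "\<phi> ?m = ?n"
    and phi_step: "\<And>c. c \<in> arcs T \<Longrightarrow> tail T c \<in> subtree ?m \<Longrightarrow>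
      \<exists>d\<in>arcs T. tail T d = \<phi> (tail T c) \<and> head T d = \<phi> (head T c) \<and> amap F d = amap F c"
    using simulation_map[OF nm] by metis
  have sub: "\<phi> x \<in> subtree ?n \<and> vmap F (\<phi> x) = vmap F x" if "x \<in> subtree ?m" for x
    using that
  proof (induction rule: subtree.induct)
    case base
    then show ?case
      using ab vmap_head[OF ab(1)] vmap_head[OF ab(2)] by (simp add: phi_m subtree.base)
  next
    case (step c)
    obtain d where d: "d \<in> arcs T" "tail T d = \<phi> (tail T c)" "head T d = \<phi> (head T c)" "amap F d = amap F c"
      using phi_step[OF step(1,2)] by blast
    have "head T d \<in> subtree ?n" using d step subtree.step[of d] by simp
    then show ?case using d vmap_head[OF d(1)] vmap_head[OF step(1)] by simp
  qed
  have disj: "x \<notin> subtree ?m" if "x \<in> subtree ?n" for x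
    using subtree_siblings_disjoint[OF ab(1,2,4,3) that] .
  have p: "tail T b \<notin> subtree ?m"
    using subtree_depth[of "tail T b" ?m] depth_head[OF ab(2)] by auto
  define v where "v x = (if x \<in> subtree ?m then \<phi> x else x)" for x
  \<comment> \<open>An arrow of a rooted tree is determined by its head, so the map on arrows is
    forced by the one on vertices.\<close>
  define w where "w c = (if head T c \<in> subtree ?m then parent_arc T (\<phi> (head T c)) else c)" for c
  have w: "w c \<in> arcs T \<and> tail T (w c) = v (tail T c) \<and> head T (w c) = v (head T c) \<and> amap F (w c) = amap F c"
    if c: "c \<in> arcs T" for c
  proof (cases "head T c \<in> subtree ?m")
    case True
    have "\<exists>d\<in>arcs T. tail T d = v (tail T c) \<and> head T d = \<phi> (head T c) \<and> amap F d = amap F c"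
    proof (cases "head T c = ?m")
      case eq: True
      \<comment> \<open>Only \<open>b\<close> enters the folded subtree from outside. It goes to
        \<open>a\<close>, which starts at the same fixed vertex.\<close>
      then have "c = b" using head_inj c ab by blast
      then show ?thesis using ab phi_m p by (intro bexI[of _ a]) (simp_all add: v_def)
    next
      case False
      then have "tail T c \<in> subtree ?m" using subtree_tail c True by blast
      then show ?thesis using phi_step[OF c] by (simp add: v_def)
    qed
    then obtain d where d: "d \<in> arcs T" "tail T d = v (tail T c)" "head T d = \<phi> (head T c)" "amap F d = amap F c"
      by blast
    have "w c = d" unfolding w_def using True d(3) parent_arc_head[OF d(1)] by simp
    then show ?thesis using d True by (simp add: v_def)
  next
    case False
    then have "tail T c \<notin> subtree ?m" using subtree.step c by blast
    then show ?thesis using False c by (simp add: v_def w_def)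
  qed
  have vv: "v (v x) = v x" for x
    using disj sub by (simp add: v_def)
  have ww: "w (w c) = w c" if "c \<in> arcs T" for c
  proof -
    have "head T (w (w c)) = head T (w c)" using w w that vv by metis
    then show ?thesis using w that head_inj by metis
  qed
  have "v ?m \<noteq> ?m" using phi_m ab head_inj subtree.base[of ?m] by (auto simp: v_def)
  moreover have "v x \<in> verts T \<and> vmap F (v x) = vmap F x" if "x \<in> verts T" for x
    using that sub[of x] subtree_verts by (auto simp: v_def)
  ultimately have "retraction \<lparr>vmap = v, amap = w\<rparr>"
    using w ww vv ab(2)
    by (auto simp: retraction_def quiver_morphism_def qmor_eq_def qmor_comp_def qmor_id_def)
  then show ?thesis by blast
qed

lemma depth_eq_0_iff: "n \<in> verts T \<Longrightarrow> depth n = 0 \<longleftrightarrow> n = tree_root T"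
proof
  assume n: "n \<in> verts T" and "depth n = 0"
  then show "n = tree_root T" using ex_in_arc[OF n] depth_head by (metis nat.distinct(1))
next
  show "n = tree_root T \<Longrightarrow> depth n = 0" by (auto simp: depth_def intro: Least_eq_0)
qed

section \<open>The fixed root and the first moved vertex of a retraction\<close>

context
  fixes i
  assumes i: "retraction i"
begin

lemma retraction_arc:
  assumes "a \<in> arcs T"
  shows "amap i a \<in> arcs T" "tail T (amap i a) = vmap i (tail T a)"
    "head T (amap i a) = vmap i (head T a)" "amap F (amap i a) = amap F a"
  using i assms by (auto simp: retraction_def quiver_morphism_def qmor_eq_def qmor_comp_def)

lemma retraction_vert:
  assumes "n \<in> verts T"
  shows "vmap i n \<in> verts T" "vmap i (vmap i n) = vmap i n" "vmap F (vmap i n) = vmap F n"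
  using i assms by (auto simp: retraction_def quiver_morphism_def qmor_eq_def qmor_comp_def)

text \<open>A morphism shifts all depths by the depth of the image of the root. Applied to that
  image itself, idempotence makes this shift equal to its own double, hence
  \<open>0\<close>.\<close>

lemma retraction_root: "vmap i (tree_root T) = tree_root T"
proof -
  have "depth (vmap i n) = depth n + depth (vmap i (tree_root T))" if "n \<in> verts T" for n
    using that
  proof (induction rule: tree_induct)
    case root
    show ?case using depth_eq_0_iff root_in_verts by simp
  next
    case (arc a)
    then show ?case using retraction_arc[OF arc(1)] depth_head[of a] depth_head[of "amap i a"] by simp
  qed
  from this[of "vmap i (tree_root T)"] show ?thesis
    using retraction_vert[OF root_in_verts] depth_eq_0_iff by simp
qed

lemma retraction_simulates:
  assumes "n \<in> verts T"
  shows "simulates (vmap i n) n"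
proof -
  have "\<exists>m. m \<in> verts T \<and> vmap i n = vmap i m \<and> n = m" using assms by blast
  then show ?thesis
  proof (coinduction arbitrary: n rule: simulates.coinduct)
    case simulates
    then show ?case using retraction_arc by (metis head_in_verts)
  qed
qed

text \<open>Otherwise fixedness would spread from the root to all vertices, and then to all arrows,
  as these are determined by their heads.\<close>

lemma retraction_first_moved:
  "\<exists>b\<in>arcs T. vmap i (tail T b) = tail T b \<and> vmap i (head T b) \<noteq> head T b"
proof (rule ccontr)
  assume no: "\<not> ?thesis"
  have v: "vmap i n = n" if "n \<in> verts T" for n
    using that
  proof (induction rule: tree_induct)
    case root
    show ?case by (rule retraction_root)
  next
    case (arc a)
    then show ?case using no by blast
  qed
  moreover have "amap i a = a" if "a \<in> arcs T" for a
    using retraction_arc[OF that] v[of "head T a"] that head_inj by simp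
  ultimately show False using i by (simp add: retraction_def qmor_eq_def qmor_id_def)
qed

lemma retraction_simulating_siblings:
  assumes "b \<in> arcs T" "vmap i (tail T b) = tail T b" "vmap i (head T b) \<noteq> head T b"
  shows "simulating_siblings (amap i b) b"
  using retraction_arc[OF assms(1)] retraction_simulates[of "head T b"] assms
  by (auto simp: simulating_siblings_def)

end

lemma ex_retraction_iff: "(\<exists>i. retraction i) \<longleftrightarrow> (\<exists>a b. simulating_siblings a b)"
  using ex_retraction retraction_first_moved retraction_simulating_siblings by metis

end

section \<open>Endomorphisms of the rooted tree module\<close>

context labelled_tree
begin

text \<open>The matrices \<open>c\<close> for which \<open>v\<^sub>n \<mapsto> (\<Sum>m. c n m \<cdot> v\<^sub>m)\<close> is an endomorphism of the rooted tree module.\<close>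

definition commuting :: "('n \<Rightarrow> 'n \<Rightarrow> 'k::field) \<Rightarrow> bool" where
  "commuting c \<longleftrightarrow>
     (\<forall>n m. c n m \<noteq> 0 \<longrightarrow> n \<in> verts T \<and> m \<in> verts T \<and> vmap F n = vmap F m) \<and>
     (\<forall>n\<in>verts T. \<forall>g\<in>arcs Q. tail Q g = vmap F n \<longrightarrow>
        (\<forall>b\<in>arcs T. (\<Sum>a | a \<in> arcs T \<and> tail T a = n \<and> amap F a = g. c (head T a) (head T b)) =
           (if amap F b = g then c n (tail T b) else 0)) \<and>
        (\<Sum>a | a \<in> arcs T \<and> tail T a = n \<and> amap F a = g. c (head T a) (tree_root T)) = 0)"

context
  fixes c :: "'n \<Rightarrow> 'n \<Rightarrow> 'k::field"
  assumes c: "commuting c"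
begin

lemma commuting_support:
  assumes "c n m \<noteq> 0"
  shows "n \<in> verts T" "m \<in> verts T" "vmap F n = vmap F m"
  using c assms by (auto simp: commuting_def)

lemma commuting_sum:
  assumes "n \<in> verts T" "g \<in> arcs Q" "tail Q g = vmap F n" "b \<in> arcs T"
  shows "(\<Sum>a | a \<in> arcs T \<and> tail T a = n \<and> amap F a = g. c (head T a) (head T b)) =
           (if amap F b = g then c n (tail T b) else 0)"
  using c assms by (simp add: commuting_def)

lemma commuting_sum_root:
  assumes "n \<in> verts T" "g \<in> arcs Q" "tail Q g = vmap F n"
  shows "(\<Sum>a | a \<in> arcs T \<and> tail T a = n \<and> amap F a = g. c (head T a) (tree_root T)) = 0"
  using c assms by (simp add: commuting_def)

text \<open>For an arrow \<open>b\<close> out of \<open>m\<close>, the nonzero entry at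
  \<open>(n, m)\<close> is a sum of entries at the heads of \<open>b\<close> and of the equally
  labelled arrows out of \<open>n\<close>. Some summand is nonzero, so the nonzero entries are an
  invariant for coinduction.\<close>

lemma commuting_simulates:
  assumes "c n m \<noteq> 0"
  shows "simulates n m"
  using assms
proof (coinduction arbitrary: n m rule: simulates.coinduct)
  case simulates
  have "\<exists>a\<in>arcs T. tail T a = n \<and> amap F a = amap F b \<and> c (head T a) (head T b) \<noteq> 0"
    if b: "b \<in> arcs T" "tail T b = m" for b
  proof -
    have "(\<Sum>a | a \<in> arcs T \<and> tail T a = n \<and> amap F a = amap F b. c (head T a) (head T b)) \<noteq> 0"
      using commuting_sum[of n "amap F b" b] commuting_support[OF simulates] simulates b
        vmap_tail[OF b(1)] amap_in_arcs by simp
    then obtain a where "a \<in> {a. a \<in> arcs T \<and> tail T a = n \<and> amap F a = amap F b}" "c (head T a) (head T b) \<noteq> 0"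
      by (rule sum.not_neutral_contains_not_neutral)
    then show ?thesis by blast
  qed
  then show ?case by blast
qed

section \<open>Endomorphisms in the absence of simulating siblings\<close>

context
  assumes no_siblings: "\<And>a b. \<not> simulating_siblings a b"
begin

lemma commuting_siblings:
  assumes "a \<in> arcs T" "b \<in> arcs T" "a \<noteq> b" "tail T a = tail T b" "amap F a = amap F b"
  shows "c (head T a) (head T b) = 0"
  using commuting_simulates no_siblings[of a b] assms by (auto simp: simulating_siblings_def)

lemma commuting_sum_single:
  assumes a: "a \<in> arcs T"
    and "\<And>a'. a' \<in> arcs T \<Longrightarrow> a' \<noteq> a \<Longrightarrow> tail T a' = tail T a \<Longrightarrow> amap F a' = amap F a \<Longrightarrow>
      c (head T a') m = 0"
  shows "(\<Sum>a' | a' \<in> arcs T \<and> tail T a' = tail T a \<and> amap F a' = amap F a. c (head T a') m) =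
    c (head T a) m"
proof -
  have "(\<Sum>a' | a' \<in> arcs T \<and> tail T a' = tail T a \<and> amap F a' = amap F a. c (head T a') m) =
    (\<Sum>a'\<in>{a}. c (head T a') m)"
    using assms by (intro sum.mono_neutral_right) auto
  then show ?thesis by simp
qed

text \<open>Equally labelled siblings contribute nothing, so the sum relating an arrow to itself has
  one term: the diagonal entries at its two ends agree.\<close>

lemma commuting_diagonal:
  assumes "n \<in> verts T"
  shows "c n n = c (tree_root T) (tree_root T)"
  using assms
proof (induction rule: tree_induct)
  case root
  show ?case ..
next
  case (arc a)
  have "c (head T a) (head T a) = c (tail T a) (tail T a)"
    using commuting_sum_single[OF arc(1), of "head T a"] commuting_siblings[OF _ arc(1)]
      commuting_sum[of "tail T a" "amap F a" a] vmap_tail amap_in_arcs arc(1)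
    by simp
  then show ?case using arc by simp
qed

definition entries :: "('n \<times> 'n) set" where
  "entries = {(n, m). n \<noteq> m \<and> c n m \<noteq> 0}"

lemma entries_simulates: "(n, m) \<in> entries\<^sup>* \<Longrightarrow> simulates n m"
  by (induction rule: rtrancl_induct)
    (auto simp: entries_def intro: simulates_refl simulates_trans commuting_simulates)

text \<open>If \<open>m\<close> simulates \<open>n\<close> as well, then no sibling of \<open>n\<close> contributes to the sum that computes
  the entry at the parents.\<close>

lemma entries_parents:
  assumes nm: "(n, m) \<in> entries" and mn: "simulates m n" and n: "n \<noteq> tree_root T"
  shows "m \<noteq> tree_root T" "(parent T n, parent T m) \<in> entries"
proof -
  have nz: "c n m \<noteq> 0" "n \<noteq> m" using nm by (auto simp: entries_def)
  obtain a where a: "a \<in> arcs T" "head T a = n" using ex_in_arc commuting_support[OF nz(1)] n by blast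
  have "c (head T a') m = 0" if "a' \<in> arcs T" "a' \<noteq> a" "tail T a' = tail T a" "amap F a' = amap F a" for a'
    using commuting_simulates[of "head T a'" m] simulates_trans[of "head T a'" m n] mn a
      no_siblings[of a' a] that
    by (auto simp: simulating_siblings_def)
  then have s: "(\<Sum>a' | a' \<in> arcs T \<and> tail T a' = tail T a \<and> amap F a' = amap F a. c (head T a') m) = c n m"
    using commuting_sum_single[OF a(1), of m] a by simp
  show m: "m \<noteq> tree_root T"
    using s nz commuting_sum_root[of "tail T a" "amap F a"] a vmap_tail amap_in_arcs by auto
  obtain b where b: "b \<in> arcs T" "head T b = m" using ex_in_arc commuting_support[OF nz(1)] m by blast
  have eq: "amap F b = amap F a" "c (tail T a) (tail T b) \<noteq> 0"
    using s nz(1) commuting_sum[of "tail T a" "amap F a" b] a b vmap_tail amap_in_arcs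
    by (auto split: if_splits)
  \<comment> \<open>With a common parent, \<open>a\<close> and \<open>b\<close> would be equally
    labelled siblings, and the entry at their heads would vanish.\<close>
  have "tail T a \<noteq> tail T b"
    using commuting_siblings[OF a(1) b(1)] eq nz a b by auto
  then show "(parent T n, parent T m) \<in> entries"
    using eq parent_head a b by (auto simp: entries_def)
qed

text \<open>All vertices on a closed path of entries simulate each other, which is what
  \<open>entries_parents\<close> needs at every step. The second assumption closes the path.\<close>

lemma entries_parents_rtrancl:
  assumes "(m, n) \<in> entries\<^sup>*" and "(n, m) \<in> entries\<^sup>*" and "m \<noteq> tree_root T"
  shows "n \<noteq> tree_root T \<and> (parent T m, parent T n) \<in> entries\<^sup>*"
  using assms
proof (induction rule: converse_rtrancl_induct)
  case base
  then show ?case by simp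
next
  case (step m y)
  have "simulates y m" using step by (meson entries_simulates rtrancl_trans)
  from entries_parents[OF step(1) this step(5)]
  have y: "y \<noteq> tree_root T" "(parent T m, parent T y) \<in> entries" .
  have "(n, y) \<in> entries\<^sup>*" using step by (meson rtrancl.rtrancl_into_rtrancl)
  then show ?case using step.IH y by (meson converse_rtrancl_into_rtrancl)
qed

text \<open>Passing to the parents lowers the depth, so only a cycle through the root could remain.
  Its next vertex is not the root, and from there the cycle can never return to the root.\<close>

lemma entries_no_cycle:
  assumes "(n, m) \<in> entries" and "(m, n) \<in> entries\<^sup>*"
  shows False
  using assms
proof (induction "depth n" arbitrary: n m rule: less_induct)
  case less
  have nz: "c n m \<noteq> 0" "n \<noteq> m" using less.prems by (auto simp: entries_def)
  show False
  proof (cases "n = tree_root T")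
    case True
    then show False
      using entries_parents_rtrancl[OF less.prems(2)] less.prems(1) nz by blast
  next
    case False
    then have m: "m \<noteq> tree_root T" and p: "(parent T n, parent T m) \<in> entries"
      using entries_parents[OF less.prems(1) entries_simulates[OF less.prems(2)]] by auto
    moreover have "(parent T m, parent T n) \<in> entries\<^sup>*"
      using entries_parents_rtrancl[OF less.prems(2)] less.prems(1) m by blast
    moreover obtain a where "a \<in> arcs T" "head T a = n"
      using ex_in_arc commuting_support[OF nz(1)] False by blast
    then have "depth (parent T n) < depth n" using depth_head parent_head by fastforce
    ultimately show False using less.hyps by blast
  qed
qed

text \<open>This is nilpotency in relational form: it permits induction on a row \<open>n\<close>
  from the rows \<open>m\<close> with \<open>(n, m)\<close> in \<open>entries\<close>.\<close>

lemma wf_entries: "wf (entries\<inverse>)"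
proof (rule finite_acyclic_wf_converse)
  have "entries \<subseteq> verts T \<times> verts T" using commuting_support by (auto simp: entries_def)
  then show "finite entries" by (rule finite_subset) simp
  show "acyclic entries" using entries_no_cycle by (auto simp: acyclic_def dest!: tranclD)
qed

context
  assumes idem: "\<And>n k. c n k = (\<Sum>m\<in>verts T. c n m * c m k)"
begin

text \<open>A nonzero product with \<open>m\<close> different from the root would be a cycle of two
  entries. So idempotence of the matrix restricts to idempotence of one element of the
  field.\<close>

lemma idempotent_root_entry: "c (tree_root T) (tree_root T) = 0 \<or> c (tree_root T) (tree_root T) = 1"
proof -
  let ?r = "tree_root T"
  have "c ?r m * c m ?r = 0" if "m \<noteq> ?r" for m
    using entries_no_cycle[of ?r m] that by (auto simp: entries_def)
  then have "(\<Sum>m\<in>verts T. c ?r m * c m ?r) = (\<Sum>m\<in>{?r}. c ?r m * c m ?r)"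
    using root_in_verts by (intro sum.mono_neutral_right) auto
  then have "c ?r ?r * c ?r ?r = c ?r ?r" using idem[of ?r ?r] by simp
  then show ?thesis by simp
qed

text \<open>The whole diagonal vanishes, so idempotence writes row \<open>n\<close> as a combination
  of the rows that its off-diagonal entries point to, and these are zero by induction.\<close>

lemma idempotent_eq_0:
  assumes "c (tree_root T) (tree_root T) = 0"
  shows "c n k = 0"
  using wf_entries
proof (induction n arbitrary: k rule: wf_induct_rule)
  case (less n)
  have "c n m * c m k = 0" if "m \<in> verts T" for m
  proof (cases "c n m = 0 \<or> n = m")
    case True
    then show ?thesis using commuting_diagonal[OF that] assms by auto
  next
    case False
    then show ?thesis using less[of m k] by (simp add: entries_def)
  qed
  then show ?case using idem[of n k] by (simp add: sum.neutral)
qed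

end

end

end

section \<open>Coordinates and the action of arrows on the module\<close>

lemma space_iff:
  "x \<in> space (rooted_tree_module T F) q \<longleftrightarrow>
    (\<forall>n. Poly_Mapping.lookup x n \<noteq> 0 \<longrightarrow> n \<in> verts T \<and> vmap F n = q)"
  for x :: "'n \<Rightarrow>\<^sub>0 'k::field"
proof -
  interpret P: vector_space "pscale :: 'k \<Rightarrow> ('n \<Rightarrow>\<^sub>0 'k) \<Rightarrow> _" by (rule vector_space_pscale)
  let ?B = "{n \<in> verts T. vmap F n = q}"
  show ?thesis
  proof
    assume "x \<in> space (rooted_tree_module T F) q"
    then have "x \<in> P.span (basis_vector ` ?B)" by (simp add: rooted_tree_module_def)
    then show "\<forall>n. Poly_Mapping.lookup x n \<noteq> 0 \<longrightarrow> n \<in> verts T \<and> vmap F n = q"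
    proof (induction rule: P.span_induct_alt)
      case base
      show ?case by simp
    next
      case (step c x y)
      then show ?case
        by (auto simp: lookup_add lookup_pscale basis_vector_def lookup_single when_def split: if_splits)
    qed
  next
    assume s: "\<forall>n. Poly_Mapping.lookup x n \<noteq> 0 \<longrightarrow> n \<in> verts T \<and> vmap F n = q"
    have "x = (\<Sum>n\<in>?B. pscale (Poly_Mapping.lookup x n) (basis_vector n))"
    proof (rule poly_mapping_eqI)
      fix m
      have "(\<Sum>n\<in>?B. Poly_Mapping.lookup x n * (1 when n = m)) =
        (\<Sum>n\<in>?B. if n = m then Poly_Mapping.lookup x n else 0)"
        by (intro sum.cong) (auto simp: when_def)
      then show "Poly_Mapping.lookup x m =
          Poly_Mapping.lookup (\<Sum>n\<in>?B. pscale (Poly_Mapping.lookup x n) (basis_vector n)) m"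
        using s by (auto simp: lookup_sum lookup_pscale basis_vector_def lookup_single)
    qed
    also have "\<dots> \<in> P.span (basis_vector ` ?B)"
      by (intro P.span_sum P.span_scale P.span_base) auto
    finally show "x \<in> space (rooted_tree_module T F) q" by (simp add: rooted_tree_module_def)
  qed
qed

lemma space_expansion:
  fixes x :: "'n \<Rightarrow>\<^sub>0 'k::field"
  assumes "x \<in> space (rooted_tree_module T F) q"
  shows "x = (\<Sum>n\<in>verts T. pscale (Poly_Mapping.lookup x n) (basis_vector n))"
proof (rule poly_mapping_eqI)
  fix m
  have "(\<Sum>n\<in>verts T. Poly_Mapping.lookup x n * (1 when n = m)) =
    (\<Sum>n\<in>verts T. if n = m then Poly_Mapping.lookup x n else 0)"
    by (intro sum.cong) (auto simp: when_def)
  then show "Poly_Mapping.lookup x m =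
      Poly_Mapping.lookup (\<Sum>n\<in>verts T. pscale (Poly_Mapping.lookup x n) (basis_vector n)) m"
    using assms by (auto simp: space_iff lookup_sum lookup_pscale basis_vector_def lookup_single)
qed

lemma lookup_act:
  "Poly_Mapping.lookup (act (rooted_tree_module T F) g x) m =
    (\<Sum>n\<in>verts T. Poly_Mapping.lookup x n *
      (\<Sum>a | a \<in> arcs T \<and> tail T a = n \<and> amap F a = g. if head T a = m then 1 else 0))"
  for x :: "'n \<Rightarrow>\<^sub>0 'k::field"
  by (simp add: rooted_tree_module_def lookup_sum lookup_pscale basis_vector_def lookup_single when_def)

text \<open>Since \<open>b\<close> is the only arrow into its head, at most one basis vector
  contributes to this coordinate.\<close>

lemma lookup_act_head:
  fixes x :: "'n \<Rightarrow>\<^sub>0 'k::field"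
  assumes b: "b \<in> arcs T"
  shows "Poly_Mapping.lookup (act (rooted_tree_module T F) g x) (head T b) =
    (if amap F b = g then Poly_Mapping.lookup x (tail T b) else 0)"
proof -
  have "(\<Sum>a | a \<in> arcs T \<and> tail T a = n \<and> amap F a = g. if head T a = head T b then 1 else 0) =
    (if n = tail T b then if amap F b = g then 1 else 0 else (0 :: 'k))" for n
  proof -
    have "(\<Sum>a | a \<in> arcs T \<and> tail T a = n \<and> amap F a = g. if head T a = head T b then 1 else 0) =
      (\<Sum>a | a \<in> arcs T \<and> tail T a = n \<and> amap F a = g. if a = b then 1 else (0 :: 'k))"
      using b by (intro sum.cong) (auto dest: head_inj)
    then show ?thesis using b by simp
  qed
  then show ?thesis using b by (simp add: lookup_act if_distrib cong: if_cong)
qed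

lemma lookup_act_root:
  "Poly_Mapping.lookup (act (rooted_tree_module T F) g x) (tree_root T) = 0"
  for x :: "'n \<Rightarrow>\<^sub>0 'k::field"
  by (auto simp: lookup_act head_ne_root intro!: sum.neutral)

lemma lookup_act_not_vert:
  fixes x :: "'n \<Rightarrow>\<^sub>0 'k::field"
  assumes "m \<notin> verts T"
  shows "Poly_Mapping.lookup (act (rooted_tree_module T F) g x) m = 0"
  using assms by (auto simp: lookup_act intro!: sum.neutral)

lemma act_eqI:
  fixes x y :: "'n \<Rightarrow>\<^sub>0 'k::field"
  assumes "\<And>b. b \<in> arcs T \<Longrightarrow> Poly_Mapping.lookup y (head T b) =
    (if amap F b = g then Poly_Mapping.lookup x (tail T b) else 0)"
    and "Poly_Mapping.lookup y (tree_root T) = 0"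
    and "\<And>m. m \<notin> verts T \<Longrightarrow> Poly_Mapping.lookup y m = 0"
  shows "act (rooted_tree_module T F) g x = y"
proof (rule poly_mapping_eqI)
  fix m
  consider "m \<notin> verts T" | "m = tree_root T" | b where "b \<in> arcs T" "head T b = m"
    using ex_in_arc by blast
  then show "Poly_Mapping.lookup (act (rooted_tree_module T F) g x) m = Poly_Mapping.lookup y m"
    using assms by cases (auto simp: lookup_act_head lookup_act_root lookup_act_not_vert)
qed

lemma act_add:
  "act (rooted_tree_module T F) g (x + y) =
    act (rooted_tree_module T F) g x + act (rooted_tree_module T F) g y"
  for x y :: "'n \<Rightarrow>\<^sub>0 'k::field"
  by (rule act_eqI) (simp_all add: lookup_add lookup_act_head lookup_act_root lookup_act_not_vert)

lemma act_basis_vector: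
  assumes "n \<in> verts T"
  shows "act (rooted_tree_module T F) g (basis_vector n :: 'n \<Rightarrow>\<^sub>0 'k::field) =
    (\<Sum>a | a \<in> arcs T \<and> tail T a = n \<and> amap F a = g. basis_vector (head T a))"
proof (rule act_eqI)
  fix b assume b: "b \<in> arcs T"
  have "(\<Sum>a | a \<in> arcs T \<and> tail T a = n \<and> amap F a = g. if head T a = head T b then 1 else 0) =
    (\<Sum>a | a \<in> arcs T \<and> tail T a = n \<and> amap F a = g. if a = b then 1 else (0 :: 'k))"
    using b by (intro sum.cong) (auto dest: head_inj)
  then show "Poly_Mapping.lookup (\<Sum>a | a \<in> arcs T \<and> tail T a = n \<and> amap F a = g. basis_vector (head T a)) (head T b) =
    (if amap F b = g then Poly_Mapping.lookup (basis_vector n :: 'n \<Rightarrow>\<^sub>0 'k) (tail T b) else 0)"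
    using b by (auto simp: lookup_sum basis_vector_def lookup_single when_def)
qed (auto simp: lookup_sum basis_vector_def lookup_single when_def head_ne_root intro!: sum.neutral)

lemma basis_vector_in_space:
  "n \<in> verts T \<Longrightarrow> basis_vector n \<in> space (rooted_tree_module T F) (vmap F n)"
  by (auto simp: space_iff basis_vector_def lookup_single when_def split: if_splits)

text \<open>Precomposing coordinates with \<open>vmap i\<close> is an idempotent endomorphism.
  \<open>U\<close> is its image and \<open>W\<close> its kernel.\<close>

lemma decomposable_of_retraction:
  assumes i: "retraction i"
  shows "\<exists>U W. subrepresentation pscale Q (rooted_tree_module T F) U \<and>
    subrepresentation pscale Q (rooted_tree_module T F) W \<and>
    direct_sum Q (rooted_tree_module T F) U W \<and>
    \<not> is_zero Q U \<and> \<not> is_zero Q (W :: 'q \<Rightarrow> ('n \<Rightarrow>\<^sub>0 'k::field) set)"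
proof -
  interpret P: vector_space "pscale :: 'k \<Rightarrow> ('n \<Rightarrow>\<^sub>0 'k) \<Rightarrow> _" by (rule vector_space_pscale)
  let ?M = "rooted_tree_module T F :: ('q, 'a, 'n \<Rightarrow>\<^sub>0 'k) representation"
  let ?l = "Poly_Mapping.lookup :: ('n \<Rightarrow>\<^sub>0 'k) \<Rightarrow> _"
  define U where "U q = {x \<in> space ?M q. \<forall>n\<in>verts T. ?l x n = ?l x (vmap i n)}" for q
  define W where "W q = {x \<in> space ?M q. \<forall>n\<in>verts T. ?l x (vmap i n) = 0}" for q
  have act_space: "act ?M g x \<in> space ?M (head Q g)" if "x \<in> space ?M (tail Q g)" for g x
    unfolding space_iff
  proof (intro allI impI)
    fix n assume n: "?l (act ?M g x) n \<noteq> 0"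
    then have "n \<in> verts T" "n \<noteq> tree_root T" by (metis lookup_act_not_vert, metis lookup_act_root)
    then obtain b where "b \<in> arcs T" "head T b = n" using ex_in_arc by blast
    then show "n \<in> verts T \<and> vmap F n = head Q g"
      using n lookup_act_head[of b g x] vmap_head by (auto split: if_splits)
  qed
  \<comment> \<open>The retraction takes arrows to arrows of the same label, so precomposition
    commutes with the action.\<close>
  have act_i: "?l (act ?M g x) (vmap i (head T b)) =
      (if amap F b = g then ?l x (vmap i (tail T b)) else 0)" if b: "b \<in> arcs T" for g x b
    using lookup_act_head[of "amap i b" g x] retraction_arc[OF i b] by simp
  have act_i_root: "?l (act ?M g x) (vmap i (tree_root T)) = 0" for g x
    by (simp add: retraction_root[OF i] lookup_act_root)
  have cases: "n = tree_root T \<or> (\<exists>b\<in>arcs T. head T b = n)" if "n \<in> verts T" for n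
    using ex_in_arc that by blast
  have space: "P.subspace (space ?M q)" for q
    by (simp add: rooted_tree_module_def)
  have subspace: "P.subspace (U q)" "P.subspace (W q)" for q
    using space[of q] by (simp_all add: P.subspace_def U_def W_def lookup_add lookup_pscale)
  have subU: "subrepresentation pscale Q ?M U"
    unfolding subrepresentation_def
  proof (intro conjI ballI)
    fix g assume g: "g \<in> arcs Q"
    show "act ?M g ` U (tail Q g) \<subseteq> U (head Q g)"
    proof (rule image_subsetI)
      fix x assume x: "x \<in> U (tail Q g)"
      have "?l (act ?M g x) n = ?l (act ?M g x) (vmap i n)" if "n \<in> verts T" for n
        using cases[OF that] x by (auto simp: act_i act_i_root lookup_act_head lookup_act_root U_def)
      then show "act ?M g x \<in> U (head Q g)" using act_space x by (simp add: U_def)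
    qed
  qed (use subspace in \<open>auto simp: U_def\<close>)
  have subW: "subrepresentation pscale Q ?M W"
    unfolding subrepresentation_def
  proof (intro conjI ballI)
    fix g assume g: "g \<in> arcs Q"
    show "act ?M g ` W (tail Q g) \<subseteq> W (head Q g)"
    proof (rule image_subsetI)
      fix x assume x: "x \<in> W (tail Q g)"
      have "?l (act ?M g x) (vmap i n) = 0" if "n \<in> verts T" for n
        using cases[OF that] x by (auto simp: act_i act_i_root W_def)
      then show "act ?M g x \<in> W (head Q g)" using act_space x by (simp add: W_def)
    qed
  qed (use subspace in \<open>auto simp: W_def\<close>)
  have "direct_sum Q ?M U W"
    unfolding direct_sum_def
  proof (intro ballI conjI equalityI subsetI)
    fix q x assume x: "x \<in> space ?M q"
    \<comment> \<open>The projection of \<open>x\<close>; the difference \<open>x - y\<close> then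
      lies in the kernel.\<close>
    define y where "y = (\<Sum>n\<in>verts T. pscale (?l x (vmap i n)) (basis_vector n))"
    have ly: "?l y m = (if m \<in> verts T then ?l x (vmap i m) else 0)" for m
    proof -
      have "(\<Sum>n\<in>verts T. ?l x (vmap i n) * (1 when n = m)) =
        (\<Sum>n\<in>verts T. if n = m then ?l x (vmap i n) else 0)"
        by (intro sum.cong) (auto simp: when_def)
      then show ?thesis
        by (simp add: y_def lookup_sum lookup_pscale basis_vector_def lookup_single)
    qed
    have y: "y \<in> U q"
      using x retraction_vert[OF i] by (auto simp: U_def space_iff ly split: if_splits)
    then have "x - y \<in> space ?M q"
      using x P.subspace_diff[OF space] by (simp add: U_def)
    then have "x - y \<in> W q"
      using retraction_vert[OF i] by (simp add: W_def ly lookup_minus)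
    with y show "x \<in> {x + y |x y. x \<in> U q \<and> y \<in> W q}"
      by (intro CollectI exI[of _ y] exI[of _ "x - y"]) simp
  next
    fix q x assume "x \<in> {x + y |x y. x \<in> U q \<and> y \<in> W q}"
    then show "x \<in> space ?M q"
      using P.subspace_add[OF space] by (auto simp: U_def W_def)
  next
    fix q x assume x: "x \<in> U q \<inter> W q"
    then have "?l x n = 0" if "n \<in> verts T" for n using that by (auto simp: U_def W_def)
    then have "x = 0" using x by (intro poly_mapping_eqI) (auto simp: U_def space_iff)
    then show "x \<in> {0}" by simp
  next
    fix q and x :: "'n \<Rightarrow>\<^sub>0 'k" assume "x \<in> {0}"
    then show "x \<in> U q \<inter> W q" by (simp add: U_def W_def space_iff)
  qed
  moreover have "\<not> is_zero Q U"
  proof -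
    let ?r = "tree_root T"
    \<comment> \<open>The indicator of the fibre over the root is unchanged by the projection, and
      it is nonzero at the root.\<close>
    define y where "y = (\<Sum>n | n \<in> verts T \<and> vmap i n = ?r. basis_vector n :: 'n \<Rightarrow>\<^sub>0 'k)"
    have ly: "?l y m = (if m \<in> verts T \<and> vmap i m = ?r then 1 else 0)" for m
      by (simp add: y_def lookup_sum basis_vector_def lookup_single when_def)
    have "y \<in> U (vmap F ?r)"
      using retraction_vert[OF i] by (auto simp: U_def space_iff ly split: if_splits) (metis)+
    moreover have "y \<noteq> 0"
      using ly[of ?r] root_in_verts retraction_root[OF i] by auto
    ultimately show ?thesis using vmap_in_verts root_in_verts by (auto simp: is_zero_def)
  qed
  moreover have "\<not> is_zero Q W"
  proof -
    obtain b where b: "b \<in> arcs T" "vmap i (head T b) \<noteq> head T b"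
      using retraction_first_moved[OF i] by blast
    let ?n = "head T b"
    \<comment> \<open>Idempotence fixes all values of the retraction, so a moved vertex is not a
      value, and its basis vector vanishes on the image.\<close>
    have "basis_vector ?n \<in> W (vmap F ?n)"
      using b basis_vector_in_space[of ?n] retraction_vert(2)[OF i]
      by (auto simp: W_def basis_vector_def lookup_single when_def)
    moreover have "basis_vector ?n \<noteq> (0 :: 'n \<Rightarrow>\<^sub>0 'k)"
      by (metis basis_vector_def lookup_single_eq lookup_zero zero_neq_one)
    ultimately show ?thesis using vmap_in_verts[of ?n] b by (auto simp: is_zero_def)
  qed
  ultimately show ?thesis using subU subW by blast
qed

lemma direct_sum_unique:
  fixes U W :: "'q \<Rightarrow> ('n \<Rightarrow>\<^sub>0 'k::field) set"
  assumes "subrepresentation pscale Q (rooted_tree_module T F) U"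
    and "subrepresentation pscale Q (rooted_tree_module T F) W"
    and "direct_sum Q (rooted_tree_module T F) U W"
    and "q \<in> verts Q" "x \<in> U q" "x' \<in> U q" "y \<in> W q" "y' \<in> W q" "x + y = x' + y'"
  shows "x = x'"
proof -
  interpret P: vector_space "pscale :: 'k \<Rightarrow> ('n \<Rightarrow>\<^sub>0 'k) \<Rightarrow> _" by (rule vector_space_pscale)
  have "x - x' = y' - y" using assms(9) by (simp add: algebra_simps)
  moreover have "x - x' \<in> U q" "y' - y \<in> W q"
    using assms by (auto simp: subrepresentation_def intro: P.subspace_diff)
  ultimately have "x - x' \<in> U q \<inter> W q" by simp
  then have "x - x' \<in> {0}" using assms(3,4) unfolding direct_sum_def by blast
  then show ?thesis by simp
qed

text \<open>\<open>c\<close> is the matrix of the projection onto \<open>U\<close> along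
  \<open>W\<close>. Rows outside the tree are set to \<open>0\<close>, so that the support condition
  of \<open>commuting\<close> and the idempotence hold for all indices.\<close>

lemma direct_sum_component:
  fixes U W :: "'q \<Rightarrow> ('n \<Rightarrow>\<^sub>0 'k::field) set" and u w :: "'n \<Rightarrow> 'n \<Rightarrow>\<^sub>0 'k"
  assumes U: "subrepresentation pscale Q (rooted_tree_module T F) U"
    and W: "subrepresentation pscale Q (rooted_tree_module T F) W"
    and UW: "direct_sum Q (rooted_tree_module T F) U W"
    and u: "\<And>n. n \<in> verts T \<Longrightarrow> u n \<in> U (vmap F n)"
    and w: "\<And>n. n \<in> verts T \<Longrightarrow> w n \<in> W (vmap F n)"
    and uw: "\<And>n. n \<in> verts T \<Longrightarrow> basis_vector n = u n + w n"
  defines "c \<equiv> \<lambda>n m. if n \<in> verts T then Poly_Mapping.lookup (u n) m else 0"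
  shows "commuting c" and "c n k = (\<Sum>m\<in>verts T. c n m * c m k)"
    and "(\<And>n m. c n m = 0) \<Longrightarrow> is_zero Q U"
proof -
  interpret P: vector_space "pscale :: 'k \<Rightarrow> ('n \<Rightarrow>\<^sub>0 'k) \<Rightarrow> _" by (rule vector_space_pscale)
  let ?M = "rooted_tree_module T F :: ('q, 'a, 'n \<Rightarrow>\<^sub>0 'k) representation"
  have sub: "P.subspace (U q)" "P.subspace (W q)" "U q \<subseteq> space ?M q" if "q \<in> verts Q" for q
    using U W that by (auto simp: subrepresentation_def)
  have act_mem: "act ?M g x \<in> U (head Q g)" if "g \<in> arcs Q" "x \<in> U (tail Q g)" for g x
    using U that unfolding subrepresentation_def by blast
  have act_mem': "act ?M g x \<in> W (head Q g)" if "g \<in> arcs Q" "x \<in> W (tail Q g)" for g x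
    using W that unfolding subrepresentation_def by blast
  have uM: "u n \<in> space ?M (vmap F n)" if "n \<in> verts T" for n
    using u[OF that] sub(3)[OF vmap_in_verts[OF that]] by blast
  \<comment> \<open>The image of a basis vector splits in two ways: act on its two parts, or take
    the parts of the basis vectors it is a sum of. Uniqueness identifies the results.\<close>
  have act_u: "act ?M g (u n) = (\<Sum>a | a \<in> arcs T \<and> tail T a = n \<and> amap F a = g. u (head T a))"
    if n: "n \<in> verts T" and g: "g \<in> arcs Q" "tail Q g = vmap F n" for n g
  proof (rule direct_sum_unique[OF U W UW])
    let ?A = "{a. a \<in> arcs T \<and> tail T a = n \<and> amap F a = g}"
    have mem: "u (head T a) \<in> U (head Q g)" "w (head T a) \<in> W (head Q g)" if "a \<in> ?A" for a
      using that u[of "head T a"] w[of "head T a"] vmap_head[of a] by auto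
    show q: "head Q g \<in> verts Q" using wf_digraph.head_in_verts[OF wf_quiver g(1)] .
    show "act ?M g (u n) \<in> U (head Q g)" "act ?M g (w n) \<in> W (head Q g)"
      using act_mem[OF g(1)] act_mem'[OF g(1)] u[OF n] w[OF n] g(2) by simp_all
    show "(\<Sum>a\<in>?A. u (head T a)) \<in> U (head Q g)"
      by (rule P.subspace_sum[OF sub(1)[OF q] mem(1)])
    show "(\<Sum>a\<in>?A. w (head T a)) \<in> W (head Q g)"
      by (rule P.subspace_sum[OF sub(2)[OF q] mem(2)])
    have "act ?M g (u n) + act ?M g (w n) = act ?M g (basis_vector n)"
      by (simp add: uw[OF n] act_add)
    also have "\<dots> = (\<Sum>a\<in>?A. u (head T a) + w (head T a))"
      by (subst act_basis_vector[OF n], rule sum.cong) (auto simp: uw)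
    finally show "act ?M g (u n) + act ?M g (w n) = (\<Sum>a\<in>?A. u (head T a)) + (\<Sum>a\<in>?A. w (head T a))"
      by (simp add: sum.distrib)
  qed
  have c_sum: "(\<Sum>a | a \<in> arcs T \<and> tail T a = n \<and> amap F a = g. c (head T a) m) =
      Poly_Mapping.lookup (act ?M g (u n)) m"
    if "n \<in> verts T" "g \<in> arcs Q" "tail Q g = vmap F n" for n g m
    unfolding act_u[OF that] lookup_sum by (rule sum.cong) (auto simp: c_def)
  show "commuting c"
    unfolding commuting_def
  proof (intro conjI allI ballI impI)
    fix n m assume "c n m \<noteq> 0"
    then show "n \<in> verts T" "m \<in> verts T" "vmap F n = vmap F m"
      using uM[of n] by (auto simp: c_def space_iff split: if_splits)
  qed (simp_all add: c_sum lookup_act_head lookup_act_root, simp add: c_def)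
  show "c n k = (\<Sum>m\<in>verts T. c n m * c m k)"
  proof (cases "n \<in> verts T")
    case False
    then show ?thesis by (simp add: c_def)
  next
    case n: True
    let ?l = "Poly_Mapping.lookup (u n)"
    note q = vmap_in_verts[OF n]
    \<comment> \<open>A coordinate of \<open>u n\<close> is nonzero only over the vertex
      \<open>vmap F n\<close>, so each summand is in the right space, trivially so where the
      coefficient is \<open>0\<close>.\<close>
    have mem: "pscale (?l m) (u m) \<in> U (vmap F n)" "pscale (?l m) (w m) \<in> W (vmap F n)"
      if "m \<in> verts T" for m
    proof -
      have "?l m = 0 \<or> vmap F m = vmap F n" using uM[OF n] by (auto simp: space_iff)
      then show "pscale (?l m) (u m) \<in> U (vmap F n)" "pscale (?l m) (w m) \<in> W (vmap F n)"
        using u[OF that] w[OF that] sub[OF q] by (auto intro: P.subspace_scale P.subspace_0)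
    qed
    have "u n = (\<Sum>m\<in>verts T. pscale (?l m) (basis_vector m))"
      by (rule space_expansion[OF uM[OF n]])
    also have "\<dots> = (\<Sum>m\<in>verts T. pscale (?l m) (u m)) + (\<Sum>m\<in>verts T. pscale (?l m) (w m))"
      unfolding sum.distrib[symmetric] by (rule sum.cong) (simp_all add: uw P.scale_right_distrib)
    \<comment> \<open>Two decompositions of the same vector; the one on the left has
      \<open>W\<close>-part \<open>0\<close>, and comparing the \<open>U\<close>-parts gives
      idempotence.\<close>
    finally have eq: "u n + 0 = \<dots>" by simp
    have "u n = (\<Sum>m\<in>verts T. pscale (?l m) (u m))"
      by (rule direct_sum_unique[OF U W UW q u[OF n]
          P.subspace_sum[OF sub(1)[OF q] mem(1)] P.subspace_0[OF sub(2)[OF q]]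
          P.subspace_sum[OF sub(2)[OF q] mem(2)] eq])
    from arg_cong[OF this, of "\<lambda>x. Poly_Mapping.lookup x k"]
    have "?l k = (\<Sum>m\<in>verts T. ?l m * Poly_Mapping.lookup (u m) k)"
      by (simp only: lookup_sum lookup_pscale)
    then show ?thesis using n by (simp add: c_def)
  qed
  show "is_zero Q U" if z: "\<And>n m. c n m = 0"
  proof -
    \<comment> \<open>With a zero matrix every basis vector lies in \<open>W\<close>, so
      \<open>U\<close> is contained in \<open>W\<close> and meets it only in
      \<open>0\<close>.\<close>
    have w_eq: "w n = basis_vector n" if "n \<in> verts T" for n
    proof -
      have "u n = 0" by (rule poly_mapping_eqI) (use z[of n] that in \<open>simp add: c_def\<close>)
      then show ?thesis using uw[OF that] by simp
    qed
    show ?thesis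
      unfolding is_zero_def
    proof (intro ballI equalityI subsetI)
      fix q x assume q: "q \<in> verts Q" and x: "x \<in> U q"
      have xM: "x \<in> space ?M q" using x sub(3)[OF q] by blast
      have "pscale (Poly_Mapping.lookup x n) (basis_vector n) \<in> W q" if "n \<in> verts T" for n
      proof -
        have "Poly_Mapping.lookup x n = 0 \<or> vmap F n = q" using xM by (auto simp: space_iff)
        then show ?thesis
          using w[OF that] w_eq[OF that] sub(2)[OF q] by (auto intro: P.subspace_scale P.subspace_0)
      qed
      then have "x \<in> W q"
        by (subst space_expansion[OF xM]) (rule P.subspace_sum[OF sub(2)[OF q]])
      then show "x \<in> {0}" using x UW q by (auto simp: direct_sum_def)
    next
      fix q and x :: "'n \<Rightarrow>\<^sub>0 'k" assume "q \<in> verts Q" "x \<in> {0}"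
      then show "x \<in> U q" using P.subspace_0[OF sub(1)] by simp
    qed
  qed
qed

text \<open>The matrices of the two projections have root entries adding up to \<open>1\<close>. As
  one of these is \<open>0\<close> or \<open>1\<close>, one matrix has root entry \<open>0\<close>
  and therefore vanishes.\<close>

lemma indecomposable_of_no_siblings:
  fixes U W :: "'q \<Rightarrow> ('n \<Rightarrow>\<^sub>0 'k::field) set"
  assumes U: "subrepresentation pscale Q (rooted_tree_module T F) U"
    and W: "subrepresentation pscale Q (rooted_tree_module T F) W"
    and UW: "direct_sum Q (rooted_tree_module T F) U W"
    and no: "\<And>a b. \<not> simulating_siblings a b"
  shows "is_zero Q U \<or> is_zero Q W"
proof -
  let ?r = "tree_root T"
  have "\<exists>x y. x \<in> U (vmap F n) \<and> y \<in> W (vmap F n) \<and> basis_vector n = x + y" if "n \<in> verts T" for n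
  proof -
    have "(basis_vector n :: 'n \<Rightarrow>\<^sub>0 'k) \<in> space (rooted_tree_module T F) (vmap F n)"
      by (rule basis_vector_in_space[OF that])
    then show ?thesis using UW vmap_in_verts[OF that] by (auto simp: direct_sum_def)
  qed
  then obtain u w where uw: "\<And>n. n \<in> verts T \<Longrightarrow> u n \<in> U (vmap F n)"
    "\<And>n. n \<in> verts T \<Longrightarrow> w n \<in> W (vmap F n)"
    "\<And>n. n \<in> verts T \<Longrightarrow> basis_vector n = u n + w n"
    by metis
  have WU: "direct_sum Q (rooted_tree_module T F) W U"
  proof -
    have "{x + y |x y. x \<in> U q \<and> y \<in> W q} = {x + y |x y. x \<in> W q \<and> y \<in> U q}" for q
      by (rule Collect_cong) (metis add.commute)
    then show ?thesis using UW by (simp add: direct_sum_def Int_commute)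
  qed
  have wu: "\<And>n. n \<in> verts T \<Longrightarrow> basis_vector n = w n + u n" using uw(3) by (simp add: add.commute)
  let ?c = "\<lambda>n m. if n \<in> verts T then Poly_Mapping.lookup (u n) m else 0"
  let ?d = "\<lambda>n m. if n \<in> verts T then Poly_Mapping.lookup (w n) m else 0"
  note c = direct_sum_component[OF U W UW uw] and d = direct_sum_component[OF W U WU uw(2,1) wu]
  have "?c ?r ?r + ?d ?r ?r = 1"
    using arg_cong[OF uw(3)[OF root_in_verts], of "\<lambda>x. Poly_Mapping.lookup x ?r"] root_in_verts
    by (simp add: basis_vector_def lookup_add)
  then have "?c ?r ?r = 0 \<or> ?d ?r ?r = 0"
    using idempotent_root_entry[OF c(1) no c(2)] by auto
  then show ?thesis
    using idempotent_eq_0[OF c(1) no c(2)] idempotent_eq_0[OF d(1) no d(2)] c(3) d(3) by metis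
qed

end

section \<open>Generalized graph maps\<close>

definition linked :: "('v, 'a) network \<Rightarrow> 'v \<Rightarrow> 'v \<Rightarrow> bool" where
  "linked N u v \<longleftrightarrow> u \<in> verts (quiver N) \<and> v \<in> verts (quiver N) \<and> (\<exists>l. link_joins N l u v)"

lemma link_joins_inverse: "link_joins N l u v \<Longrightarrow> link_joins N (link_inverse l) v u"
  by (cases l) auto

lemma link_joins_unique: "link_joins N l u v \<Longrightarrow> link_joins N l u v' \<Longrightarrow> v = v'"
  by (cases l) (auto simp: doubleton_eq_iff)

lemma linked_sym: "linked N u v \<Longrightarrow> linked N v u"
  unfolding linked_def using link_joins_inverse by metis

text \<open>The walk is kept reduced while it is built from its end: if the new link cancels against
  the first link of the traversal, that link is dropped instead.\<close>

lemma linked_rtranclp_traversal: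
  assumes "(linked N)\<^sup>*\<^sup>* u v" and "v \<in> verts (quiver N)"
  shows "\<exists>t\<in>traversals N. fst t = u \<and> last (walk_verts t) = v"
  using assms(1)
proof (induction rule: converse_rtranclp_induct)
  case base
  show ?case using assms(2) by (intro bexI[of _ "(v, [])"]) (simp_all add: traversals_def walk_verts_def)
next
  case (step u w)
  obtain l where l: "link_joins N l u w" and u: "u \<in> verts (quiver N)" using step(1) by (auto simp: linked_def)
  obtain xs where xs: "(w, xs) \<in> traversals N" "last (walk_verts (w, xs)) = v"
    using step.IH by (metis prod.collapse)
  show ?case
  proof (cases "\<exists>v' ys. xs = (link_inverse l, v') # ys")
    case True
    then obtain v' ys where ys: "xs = (link_inverse l, v') # ys" by blast
    \<comment> \<open>A link and one of its ends determine the other end, so the shortened walk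
      starts at \<open>u\<close>.\<close>
    then have "v' = u"
      using xs(1) link_joins_inverse[OF l] link_joins_unique[of N "link_inverse l" w v' u] by (auto simp: traversals_def)
    then have "(u, ys) \<in> traversals N" "last (walk_verts (u, ys)) = v"
      using xs ys by (cases ys; auto simp: traversals_def walk_verts_def)+
    then show ?thesis by force
  next
    case False
    then have "(u, (l, w) # xs) \<in> traversals N"
      using xs(1) l u by (cases xs) (auto simp: traversals_def)
    moreover have "last (walk_verts (u, (l, w) # xs)) = v"
      using xs(2) by (simp add: walk_verts_def)
    ultimately show ?thesis by force
  qed
qed

lemma network_connectedI:
  assumes "\<And>u. u \<in> verts (quiver N) \<Longrightarrow> (linked N)\<^sup>*\<^sup>* u z"
  shows "network_connected N"
  unfolding network_connected_def
proof (intro ballI)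
  fix u v assume "u \<in> verts (quiver N)" "v \<in> verts (quiver N)"
  moreover have "symp (linked N)\<^sup>*\<^sup>*" by (rule symp_rtranclp) (auto intro: sympI linked_sym)
  ultimately have "(linked N)\<^sup>*\<^sup>* u v"
    using assms by (meson sympD rtranclp_trans)
  then show "\<exists>t\<in>traversals N. fst t = u \<and> last (walk_verts t) = v"
    using linked_rtranclp_traversal \<open>v \<in> verts (quiver N)\<close> by metis
qed

context labelled_tree
begin

section \<open>Lifting and triangles in the networks\<close>

lemma pullback_arc_iff:
  "(a, b) \<in> arcs (quiver (pullback_network T F T F)) \<longleftrightarrow> a \<in> arcs T \<and> b \<in> arcs T \<and> amap F a = amap F b"
  "tail (quiver (pullback_network T F T F)) (a, b) = (tail T a, tail T b)"
  "head (quiver (pullback_network T F T F)) (a, b) = (head T a, head T b)"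
  by (simp_all add: pullback_network_def Let_def)

lemma pullback_edge:
  assumes "e \<in> edges (pullback_network T F T F)"
  obtains n n' m where "e = {(n, m), (n', m)}" "n \<noteq> n'"
  using assms by (auto simp: pullback_network_def Let_def)

lemma covering_vert_iff:
  "(n, m, j) \<in> verts (quiver (covering_network T F T F)) \<longleftrightarrow>
    n \<in> verts T \<and> m \<in> verts T \<and> vmap F n = vmap F m \<and> j \<in> {-1, 1}"
  by (simp add: covering_network_def pullback_network_def Let_def)

lemma covering_arc_iff:
  "(a, b, j) \<in> arcs (quiver (covering_network T F T F)) \<longleftrightarrow>
    a \<in> arcs T \<and> b \<in> arcs T \<and> amap F a = amap F b \<and> j \<in> {-1, 1}"
  "tail (quiver (covering_network T F T F)) (a, b, j) = (tail T a, tail T b, j)"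
  "head (quiver (covering_network T F T F)) (a, b, j) = (head T a, head T b, j)"
  by (simp_all add: covering_network_def pullback_network_def Let_def)

text \<open>Completeness lifts each arrow out of \<open>m\<close> to an arrow of \<open>G\<close>,
  whose head is again a vertex of \<open>G\<close>. So the vertices of \<open>G\<close> are an
  invariant for coinduction.\<close>

lemma graph_map_simulates:
  assumes G: "generalized_graph_map T F T F G" and v: "(n, m, j) \<in> verts (quiver G)"
  shows "simulates n m"
  using v
proof (coinduction arbitrary: n m rule: simulates.coinduct)
  case simulates
  have sub: "arcs (quiver G) \<subseteq> arcs (quiver (covering_network T F T F))"
    "wf_digraph (quiver G)" "head (quiver G) = head (quiver (covering_network T F T F))"
    using G by (auto simp: generalized_graph_map_def subnetwork_def subgraph_def compatible_def)
  have "\<exists>a\<in>arcs T. tail T a = n \<and> amap F a = amap F b \<and> (head T a, head T b, j) \<in> verts (quiver G)"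
    if b: "b \<in> arcs T" "tail T b = m" for b
  proof -
    obtain a where a: "a \<in> arcs T" "tail T a = n" "(a, b, j) \<in> arcs (quiver G)"
      using G simulates b unfolding generalized_graph_map_def complete_network_def by blast
    then show ?thesis
      using subsetD[OF sub(1) a(3)] wf_digraph.head_in_verts[OF sub(2) a(3)] sub(3)
      by (auto simp: covering_arc_iff)
  qed
  then show ?case by blast
qed

text \<open>No two links join the same pair of vertices, so three links on three vertices join every
  pair. An edge preserves the second component; an arrow follows arrows of \<open>T\<close> in
  both.\<close>

lemma triangle_linked:
  assumes tri: "triangle (pullback_network T F T F) S" and xy: "x \<in> S" "y \<in> S" "x \<noteq> y"
  shows "snd x = snd y \<or>
    (\<exists>a\<in>arcs T. \<exists>b\<in>arcs T. (x = (tail T a, tail T b) \<and> y = (head T a, head T b)) \<or>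
       (y = (tail T a, tail T b) \<and> x = (head T a, head T b)))"
proof -
  let ?N = "pullback_network T F T F"
  define A where "A = {c \<in> arcs (quiver ?N). tail (quiver ?N) c \<in> S \<and> head (quiver ?N) c \<in> S}"
  define E where "E = {e \<in> edges ?N. e \<subseteq> S}"
  define g where "g c = {tail (quiver ?N) c, head (quiver ?N) c}" for c
  let ?P = "{e. e \<subseteq> S \<and> card e = 2}"
  have S: "card S = 3" "card A + card E = 3"
    using tri by (simp_all add: triangle_def induced_subnetwork_def induce_subgraph_def A_def E_def)
  have finS: "finite S" using S(1) by (intro card_ge_0_finite) simp
  have finP: "finite ?P" by (rule finite_subset[of _ "Pow S"]) (use finS in auto)
  have "finite A"
    by (rule finite_subset[of _ "arcs T \<times> arcs T"]) (auto simp: A_def pullback_arc_iff)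
  have "inj_on g A"
  proof (rule inj_onI)
    fix c c' assume c: "c \<in> A" "c' \<in> A" "g c = g c'"
    obtain a b a' b' where ab: "c = (a, b)" "c' = (a', b')" by (cases c, cases c')
    have arcs: "a \<in> arcs T" "b \<in> arcs T" "a' \<in> arcs T" "b' \<in> arcs T"
      using c by (auto simp: ab A_def pullback_arc_iff)
    \<comment> \<open>Depth rules out opposite arrows between the same two vertices; then the heads
      agree and determine both arrows.\<close>
    have "\<not> (tail T b = head T b' \<and> head T b = tail T b')"
      using depth_head[OF arcs(2)] depth_head[OF arcs(4)] by auto
    then have "head T a = head T a' \<and> head T b = head T b'"
      using c(3) by (auto simp: ab g_def pullback_arc_iff doubleton_eq_iff)
    then show "c = c'" using head_inj arcs ab by blast
  qed
  have "g ` A \<subseteq> ?P" "E \<subseteq> ?P" "g ` A \<inter> E = {}"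
  proof -
    have "tail T b \<noteq> head T b" if "b \<in> arcs T" for b using depth_head[OF that] by auto
    then show "g ` A \<subseteq> ?P" by (auto simp: A_def g_def pullback_arc_iff)
    have E2: "\<exists>n n' m. e = {(n, m), (n', m)} \<and> n \<noteq> n'" if "e \<in> E" for e
      using that pullback_edge by (metis (lifting) E_def mem_Collect_eq)
    show "E \<subseteq> ?P"
    proof
      fix e assume e: "e \<in> E"
      obtain n n' m where "e = {(n, m), (n', m)}" "n \<noteq> n'" using E2[OF e] by blast
      then have "card e = 2" by simp
      then show "e \<in> ?P" using e by (simp add: E_def)
    qed
    show "g ` A \<inter> E = {}"
    proof (rule equals0I)
      fix e assume "e \<in> g ` A \<inter> E"
      then obtain a b where e: "e = {(tail T a, tail T b), (head T a, head T b)}" "b \<in> arcs T" "e \<in> E"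
        by (auto simp: A_def g_def pullback_arc_iff)
      have "tail T b = head T b" using E2[OF e(3)] e(1) by (auto simp: doubleton_eq_iff)
      then show False using depth_head[OF e(2)] by simp
    qed
  qed
  then have sub: "g ` A \<union> E \<subseteq> ?P" and disj: "g ` A \<inter> E = {}" by auto
  have "finite E" using finP \<open>E \<subseteq> ?P\<close> by (rule rev_finite_subset)
  have "card (g ` A \<union> E) = card (g ` A) + card E"
    using \<open>finite A\<close> \<open>finite E\<close> disj by (intro card_Un_disjoint) auto
  also have "\<dots> = card ?P"
    using card_image[OF \<open>inj_on g A\<close>] S n_subsets[OF finS, of 2] by (simp add: numeral_eq_Suc)
  finally have "g ` A \<union> E = ?P" using card_subset_eq[OF finP sub] by blast
  moreover have "{x, y} \<in> ?P" using xy by simp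
  ultimately have "{x, y} \<in> g ` A \<union> E" by (simp only:)
  then consider "{x, y} \<in> E" | c where "c \<in> A" "{x, y} = g c" by (elim UnE imageE)
  then show ?thesis
  proof cases
    case 1
    then obtain n n' m where "{x, y} = {(n, m), (n', m)}" using pullback_edge by (metis (lifting) E_def mem_Collect_eq)
    then show ?thesis by (auto simp: doubleton_eq_iff)
  next
    case 2
    obtain a b where "c = (a, b)" by (cases c)
    then show ?thesis using 2 xy by (fastforce simp: A_def g_def pullback_arc_iff doubleton_eq_iff)
  qed
qed

section \<open>The generalized graph map of a retraction\<close>

context
  fixes i b
  assumes i: "retraction i"
    and b: "b \<in> arcs T" "vmap i (tail T b) = tail T b" "vmap i (head T b) \<noteq> head T b"
begin

text \<open>With the sheet \<open>s\<close> as a parameter, the graph of the retraction and the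
  diagonal are treated by the same formulas.\<close>

definition lift_vert :: "int \<Rightarrow> 'n \<Rightarrow> 'n" where
  "lift_vert s k = (if s = 1 then vmap i k else k)"

definition lift_arc :: "int \<Rightarrow> 'e \<Rightarrow> 'e" where
  "lift_arc s c = (if s = 1 then amap i c else c)"

definition fold_map :: "('n \<times> 'n \<times> int, 'e \<times> 'e \<times> int) network" where
  "fold_map =
    \<lparr>quiver =
       \<lparr>verts = {(lift_vert s k, k, s) | s k. s \<in> {-1, 1} \<and> k \<in> subtree (head T b)},
        arcs = {(lift_arc s c, c, s) | s c. s \<in> {-1, 1} \<and> c \<in> arcs T \<and> tail T c \<in> subtree (head T b)},
        tail = tail (quiver (covering_network T F T F)),
        head = head (quiver (covering_network T F T F))\<rparr>,
     edges = {{(vmap i (head T b), head T b, 1), (head T b, head T b, -1)}}\<rparr>"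

lemma lift_arc:
  assumes "c \<in> arcs T"
  shows "lift_arc s c \<in> arcs T" "tail T (lift_arc s c) = lift_vert s (tail T c)"
    "head T (lift_arc s c) = lift_vert s (head T c)" "amap F (lift_arc s c) = amap F c"
  using retraction_arc[OF i assms] assms by (simp_all add: lift_arc_def lift_vert_def)

lemma lift_vert:
  assumes "k \<in> verts T"
  shows "lift_vert s k \<in> verts T" "vmap F (lift_vert s k) = vmap F k"
  using retraction_vert[OF i assms] assms by (simp_all add: lift_vert_def)

text \<open>A fixed head would force its incoming arrow to be fixed, and with it the tail. So being
  moved passes down from \<open>head T b\<close>, which keeps the two sheets apart.\<close>

lemma moved:
  assumes "k \<in> subtree (head T b)"
  shows "vmap i k \<noteq> k"
  using assms
proof (induction rule: subtree.induct)
  case base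
  show ?case by (rule b(3))
next
  case (step c)
  show ?case
  proof
    assume "vmap i (head T c) = head T c"
    then have "amap i c = c" using retraction_arc[OF i step(1)] step(1) head_inj by simp
    then show False using retraction_arc(2)[OF i step(1)] step.IH by simp
  qed
qed

lemma lift_vert_neg:
  "s \<in> {-1, 1} \<Longrightarrow> k \<in> subtree (head T b) \<Longrightarrow> lift_vert (- s) k \<noteq> lift_vert s k"
  using moved[of k] by (auto simp: lift_vert_def)

lemma fold_map_vert_iff:
  "(n, k, s) \<in> verts (quiver fold_map) \<longleftrightarrow>
    s \<in> {-1, 1} \<and> k \<in> subtree (head T b) \<and> n = lift_vert s k"
  by (auto simp: fold_map_def)

lemma fold_map_arc_iff:
  "(a, c, s) \<in> arcs (quiver fold_map) \<longleftrightarrow>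
    s \<in> {-1, 1} \<and> c \<in> arcs T \<and> tail T c \<in> subtree (head T b) \<and> a = lift_arc s c"
  by (auto simp: fold_map_def)

lemma fold_map_tail_head:
  "tail (quiver fold_map) (a, c, s) = (tail T a, tail T c, s)"
  "head (quiver fold_map) (a, c, s) = (head T a, head T c, s)"
  by (simp_all add: fold_map_def covering_arc_iff)

text \<open>The single edge in a form symmetric in the sheets, so that both of its ends can be
  handled at once.\<close>

lemma fold_map_edge:
  "s \<in> {-1, 1} \<Longrightarrow> e \<in> edges fold_map \<longleftrightarrow>
    e = {(lift_vert s (head T b), head T b, s), (lift_vert (- s) (head T b), head T b, - s)}"
  by (auto simp: fold_map_def lift_vert_def)

lemma head_b_not_root: "head T b \<noteq> tree_root T" "vmap i (head T b) \<noteq> tree_root T"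
  using head_ne_root[OF b(1)] head_ne_root[OF retraction_arc(1)[OF i b(1)]] retraction_arc(3)[OF i b(1)]
  by simp_all

lemma parent_head_b:
  "parent T (vmap i (head T b)) = parent T (head T b)"
  "amap F (parent_arc T (vmap i (head T b))) = amap F (parent_arc T (head T b))"
  using parent_head[OF b(1)] parent_head[OF retraction_arc(1)[OF i b(1)]] retraction_arc[OF i b(1)]
    parent_arc_head[OF b(1)] parent_arc_head[OF retraction_arc(1)[OF i b(1)]] b(2)
  by simp_all

lemma fold_map_subnetwork: "subnetwork fold_map (covering_network T F T F)"
proof -
  let ?N = "covering_network T F T F"
  have net: "is_network ?N"
    by (rule covering_network_is_network(2)[OF wf_digraph_axioms wf_digraph_axioms morphism morphism])
  have hb: "head T b \<in> subtree (head T b)" using b(1) by (simp add: subtree.base)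
  have wf: "wf_digraph (quiver fold_map)"
  proof
    fix e assume "e \<in> arcs (quiver fold_map)"
    then show "tail (quiver fold_map) e \<in> verts (quiver fold_map)"
      "head (quiver fold_map) e \<in> verts (quiver fold_map)"
      by (cases e; simp add: fold_map_arc_iff fold_map_vert_iff fold_map_tail_head lift_arc subtree.step)+
  qed
  have "verts (quiver fold_map) \<subseteq> verts (quiver ?N)"
    by (auto simp: fold_map_vert_iff covering_vert_iff lift_vert subtree_verts)
  moreover have "arcs (quiver fold_map) \<subseteq> arcs (quiver ?N)"
    by (auto simp: fold_map_arc_iff covering_arc_iff lift_arc)
  ultimately have "subgraph (quiver fold_map) (quiver ?N)"
    using wf net by (simp add: subgraph_def is_network_def compatible_def fold_map_def)
  moreover have "is_network fold_map"
    unfolding is_network_def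
  proof (intro conjI ballI wf)
    fix e assume "e \<in> edges fold_map"
    then show "\<exists>u\<in>verts (quiver fold_map). \<exists>v\<in>verts (quiver fold_map). u \<noteq> v \<and> e = {u, v}"
      using fold_map_edge[of 1 e] hb
      by (intro bexI[of _ "(lift_vert 1 (head T b), head T b, 1)"]
          bexI[of _ "(lift_vert (- 1) (head T b), head T b, - 1)"]) (simp_all add: fold_map_vert_iff)
  qed
  moreover have "edges fold_map \<subseteq> edges ?N"
  proof -
    have "{(vmap i (head T b), head T b), (head T b, head T b)} \<in> edges (pullback_network T F T F)"
      unfolding pullback_network_def Let_def network.select_convs
      using b(1,3) head_b_not_root parent_head_b retraction_vert[OF i, of "head T b"]
      by (intro CollectI exI[of _ "vmap i (head T b)"] exI[of _ "head T b"]) simp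
    then have "{(vmap i (head T b), head T b, 1), (head T b, head T b, - 1)} \<in> edges ?N"
      unfolding covering_network_def Let_def network.select_convs
      by (intro CollectI exI[of _ "vmap i (head T b)"] exI[of _ "head T b"] exI[of _ 1]) simp
    then show ?thesis by (simp add: fold_map_def)
  qed
  ultimately show ?thesis using net by (simp add: subnetwork_def)
qed

text \<open>At the top of either sheet the incoming arrow is answered by the edge, elsewhere by the
  lift of the arrow into \<open>k\<close>. Arrows out of \<open>k\<close> lift within the
  sheet.\<close>

lemma fold_map_complete: "complete_network T F T fold_map"
proof -
  have "(\<forall>a\<in>arcs T. head T a = n \<longrightarrow>
           (\<exists>b'\<in>arcs T. head T b' = k \<and> (a, b', s) \<in> arcs (quiver fold_map)) \<or>
           (\<exists>a'\<in>arcs T. tail T a' = tail T a \<and> amap F a = amap F a' \<and>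
              (head T a', k, -s) \<in> verts (quiver fold_map) \<and>
              {(n, k, s), (head T a', k, -s)} \<in> edges fold_map))"
    "(\<forall>b'\<in>arcs T. tail T b' = k \<longrightarrow>
           (\<exists>a\<in>arcs T. tail T a = n \<and> (a, b', s) \<in> arcs (quiver fold_map)))"
    if "(n, k, s) \<in> verts (quiver fold_map)" for n k s
  proof -
    have v: "s \<in> {-1, 1}" "k \<in> subtree (head T b)" "n = lift_vert s k"
      using that by (auto simp: fold_map_vert_iff)
    show "\<forall>b'\<in>arcs T. tail T b' = k \<longrightarrow> (\<exists>a\<in>arcs T. tail T a = n \<and> (a, b', s) \<in> arcs (quiver fold_map))"
    proof (intro ballI impI)
      fix d assume "d \<in> arcs T" "tail T d = k"
      then show "\<exists>a\<in>arcs T. tail T a = n \<and> (a, d, s) \<in> arcs (quiver fold_map)"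
        using v by (intro bexI[of _ "lift_arc s d"]) (simp_all add: fold_map_arc_iff lift_arc)
    qed
    show "\<forall>a\<in>arcs T. head T a = n \<longrightarrow>
           (\<exists>b'\<in>arcs T. head T b' = k \<and> (a, b', s) \<in> arcs (quiver fold_map)) \<or>
           (\<exists>a'\<in>arcs T. tail T a' = tail T a \<and> amap F a = amap F a' \<and>
              (head T a', k, -s) \<in> verts (quiver fold_map) \<and>
              {(n, k, s), (head T a', k, -s)} \<in> edges fold_map)"
    proof (intro ballI impI)
      fix a assume a: "a \<in> arcs T" "head T a = n"
      have eq: "a = lift_arc s d" if "d \<in> arcs T" "head T d = k" for d
        using head_inj[OF a(1) lift_arc(1)[OF that(1)]] lift_arc(3)[OF that(1)] a v that by simp
      show "(\<exists>b'\<in>arcs T. head T b' = k \<and> (a, b', s) \<in> arcs (quiver fold_map)) \<or>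
           (\<exists>a'\<in>arcs T. tail T a' = tail T a \<and> amap F a = amap F a' \<and>
              (head T a', k, -s) \<in> verts (quiver fold_map) \<and>
              {(n, k, s), (head T a', k, -s)} \<in> edges fold_map)"
      proof (cases "k = head T b")
        case True
        \<comment> \<open>The tail of \<open>b\<close> is fixed, so the first components at the two
          tops have the same parent.\<close>
        have "lift_vert (- s) (tail T b) = lift_vert s (tail T b)"
          using b(2) by (simp add: lift_vert_def)
        then have "tail T (lift_arc (- s) b) = tail T a" "amap F a = amap F (lift_arc (- s) b)"
          using eq[OF b(1)] True by (simp_all add: lift_arc[OF b(1)])
        moreover have "(head T (lift_arc (- s) b), k, -s) \<in> verts (quiver fold_map)"
          using v by (auto simp: lift_arc[OF b(1)] True fold_map_vert_iff)
        moreover have "{(n, k, s), (head T (lift_arc (- s) b), k, -s)} \<in> edges fold_map"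
          using v(1) by (simp add: fold_map_edge[OF v(1)] lift_arc[OF b(1)] True v(3))
        ultimately show ?thesis using lift_arc(1)[OF b(1)] by blast
      next
        case False
        obtain d where d: "d \<in> arcs T" "head T d = k" "tail T d \<in> subtree (head T b)"
          using v(2) False by (cases rule: subtree.cases) auto
        then show ?thesis using eq[OF d(1,2)] v(1) by (auto simp: fold_map_arc_iff)
      qed
    qed
  qed
  then show ?thesis unfolding complete_network_def by blast
qed

text \<open>Each vertex climbs within its sheet to the top, where the edge leads to the other
  sheet.\<close>

lemma fold_map_connected: "network_connected fold_map"
proof (rule network_connectedI)
  let ?m = "head T b"
  have hb: "?m \<in> subtree ?m" using b(1) by (simp add: subtree.base)
  fix u assume "u \<in> verts (quiver fold_map)"
  then obtain s k where u: "u = (lift_vert s k, k, s)" "s \<in> {-1, 1}" "k \<in> subtree ?m"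
    by (cases u) (auto simp: fold_map_vert_iff)
  have up: "(linked fold_map)\<^sup>*\<^sup>* (lift_vert s k, k, s) (lift_vert s ?m, ?m, s)"
    using u(3)
  proof (induction rule: subtree.induct)
    case base
    show ?case by simp
  next
    case (step c)
    have "link_joins fold_map (Inverse (lift_arc s c, c, s))
      (lift_vert s (head T c), head T c, s) (lift_vert s (tail T c), tail T c, s)"
      using step u(2) by (simp add: fold_map_arc_iff fold_map_tail_head lift_arc)
    then have "linked fold_map (lift_vert s (head T c), head T c, s) (lift_vert s (tail T c), tail T c, s)"
      using step u(2) subtree.step unfolding linked_def fold_map_vert_iff by blast
    then show ?case using step.IH by (meson converse_rtranclp_into_rtranclp)
  qed
  have "link_joins fold_map (Edge {(lift_vert (-1) ?m, ?m, -1), (lift_vert 1 ?m, ?m, 1)})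
    (lift_vert (-1) ?m, ?m, -1) (lift_vert 1 ?m, ?m, 1)"
    using fold_map_edge[of "-1"] by simp
  then have "linked fold_map (lift_vert (-1) ?m, ?m, -1) (lift_vert 1 ?m, ?m, 1)"
    using hb unfolding linked_def fold_map_vert_iff by blast
  then have "(linked fold_map)\<^sup>*\<^sup>* (lift_vert s ?m, ?m, s) (lift_vert 1 ?m, ?m, 1)"
    using u(2) by auto
  with up show "(linked fold_map)\<^sup>*\<^sup>* u (lift_vert 1 ?m, ?m, 1)" unfolding u(1) by (rule rtranclp_trans)
qed

lemma fold_map_involution_free: "involution_free fold_map"
  using lift_vert_neg by (fastforce simp: involution_free_def fold_map_vert_iff)

abbreviation (input) "lifted s k \<equiv> (lift_vert s k, k, s)"

lemma fold_map_link_cases: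
  assumes "link_joins fold_map l x y"
  obtains (down) s c where "s \<in> {-1, 1}" "c \<in> arcs T" "tail T c \<in> subtree (head T b)"
      "x = lifted s (tail T c)" "y = lifted s (head T c)"
  | (up) s c where "s \<in> {-1, 1}" "c \<in> arcs T" "tail T c \<in> subtree (head T b)"
      "x = lifted s (head T c)" "y = lifted s (tail T c)"
  | (edge) s where "s \<in> {-1, 1}" "x = lifted s (head T b)" "y = lifted (- s) (head T b)"
proof (cases l)
  case (Arrow e)
  then obtain a c s where "e = (a, c, s)" by (cases e)
  then show ?thesis using Arrow assms down[of s c]
    by (auto simp: fold_map_arc_iff fold_map_tail_head lift_arc)
next
  case (Inverse e)
  then obtain a c s where "e = (a, c, s)" by (cases e)
  then show ?thesis using Inverse assms up[of s c]
    by (auto simp: fold_map_arc_iff fold_map_tail_head lift_arc)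
next
  case (Edge e)
  have "e \<in> edges fold_map \<and> e = {x, y}" using assms unfolding Edge link_joins.simps .
  then have "{x, y} = {lifted 1 (head T b), lifted (- 1) (head T b)}"
    using fold_map_edge[of 1 e] by blast
  then show ?thesis using edge[of 1] edge[of "-1"] by (auto simp: doubleton_eq_iff)
qed

text \<open>This excludes a walk made of the edge and an arrow. The third side of the triangle would
  be an arrow, but the only arrow into the lower first component starts at the top of sheet
  \<open>s\<close>, which differs from that of sheet \<open>- s\<close>.\<close>

lemma fold_map_no_triangle_edge:
  assumes s: "s \<in> {-1, 1}" and c: "c \<in> arcs T" "tail T c = head T b"
    and tri: "triangle (pullback_network T F T F) S"
    and xz: "(lift_vert (- s) (head T b), head T b) \<in> S" "(lift_vert s (head T c), head T c) \<in> S"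
  shows False
proof -
  have d: "depth (head T c) = Suc (depth (head T b))" using depth_head[OF c(1)] c(2) by simp
  then have "(lift_vert (- s) (head T b), head T b) \<noteq> (lift_vert s (head T c), head T c)" by auto
  from triangle_linked[OF tri xz this] d obtain a a' where a: "a \<in> arcs T" "a' \<in> arcs T"
    "lift_vert (- s) (head T b) = tail T a" "lift_vert s (head T c) = head T a"
    using depth_head by fastforce
  have "a = lift_arc s c"
    using head_inj[OF a(1) lift_arc(1)[OF c(1)]] lift_arc(3)[OF c(1)] a(4) by simp
  then have "lift_vert (- s) (head T b) = lift_vert s (head T b)"
    using a(3) lift_arc(2)[OF c(1)] c(2) by simp
  then show False using lift_vert_neg[OF s, of "head T b"] b(1) by (simp add: subtree.base)
qed

text \<open>In a triangle the two ends of the walk are linked. Two arrows in one direction change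
  the depth by two, and arrows up and then down lead to a sibling unless they cancel. The edge
  followed or preceded by an arrow is the case of \<open>fold_map_no_triangle_edge\<close>.\<close>

lemma fold_map_triangle_free:
  "traversals fold_map \<inter> covering_triangle_traversals T F T F = {}"
proof (rule equals0I)
  fix t assume t: "t \<in> traversals fold_map \<inter> covering_triangle_traversals T F T F"
  then have "forget_sign_walk t \<in> triangle_traversals T F T F"
    by (simp add: covering_triangle_traversals_def)
  then have len: "length (snd (forget_sign_walk t)) = 2"
    and tri: "triangle (pullback_network T F T F) (set (walk_verts (forget_sign_walk t)))"
    by (auto simp: triangle_traversals_def)
  obtain x l y l' z where xyz: "t = (x, [(l, y), (l', z)])"
    using len by (cases t) (auto simp: forget_sign_walk_def numeral_2_eq_2 length_Suc_conv)
  let ?S = "{forget_sign x, forget_sign y, forget_sign z}"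
  have S: "set (walk_verts (forget_sign_walk t)) = ?S"
    by (simp add: xyz forget_sign_walk_def walk_verts_def)
  have "card ?S = 3" using tri by (simp add: S triangle_def)
  then have xz: "forget_sign x \<noteq> forget_sign z" by (auto simp: card_insert_if split: if_splits)
  note lk = triangle_linked[OF tri[unfolded S], of "forget_sign x" "forget_sign z", OF _ _ xz]
  have joins: "link_joins fold_map l x y" "link_joins fold_map l' y z"
    using t by (auto simp: xyz traversals_def)
  \<comment> \<open>No arrow of \<open>fold_map\<close> enters a top, as the parent of
    \<open>head T b\<close> is outside the subtree.\<close>
  have sub: "tail T c \<notin> subtree (head T b)" if "c \<in> arcs T" "head T c = head T b" for c
    using subtree_depth[of "tail T c" "head T b"] depth_head[OF that(1)] that by auto
  have edge: False if "s \<in> {-1, 1}" "c \<in> arcs T" "tail T c = head T b"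
    "(lift_vert (- s) (head T b), head T b) \<in> ?S" "(lift_vert s (head T c), head T c) \<in> ?S" for s c
    using fold_map_no_triangle_edge[OF that(1-3) tri[unfolded S] that(4,5)] .
  \<comment> \<open>An arrow changes the depth by exactly one and an edge preserves the second
    component, so linked ends of equal depth agree there.\<close>
  have near: "depth (snd (forget_sign x)) \<le> Suc (depth (snd (forget_sign z)))"
    "depth (snd (forget_sign z)) \<le> Suc (depth (snd (forget_sign x)))"
    "depth (snd (forget_sign x)) = depth (snd (forget_sign z)) \<Longrightarrow>
      snd (forget_sign x) = snd (forget_sign z)"
    using lk depth_head by fastforce+
  show False
    using joins(1)
  proof (cases rule: fold_map_link_cases)
    case (down s c)
    show False
      using joins(2)
    proof (cases rule: fold_map_link_cases)
      case (down s' c')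
      then show False
        using \<open>x = _\<close> \<open>y = lifted s (head T c)\<close> near(2) depth_head[OF \<open>c \<in> arcs T\<close>] depth_head[OF \<open>c' \<in> arcs T\<close>]
        by (simp add: forget_sign_def)
    next
      case (up s' c')
      then have "c' = c" using head_inj \<open>c \<in> arcs T\<close> \<open>y = lifted s (head T c)\<close> by auto
      then show False using up \<open>x = _\<close> \<open>y = lifted s (head T c)\<close> xz by simp
    next
      case (edge s')
      then show False using down sub by simp
    qed
  next
    case (up s c)
    show False
      using joins(2)
    proof (cases rule: fold_map_link_cases)
      case (down s' c')
      then have "c' = c"
        using up near(3) depth_head[of c] depth_head[of c'] head_inj by (auto simp: forget_sign_def)
      then show False using down up xz by simp
    next
      case (up s' c')
      then show False
        using \<open>x = _\<close> \<open>y = lifted s (tail T c)\<close> near(1) depth_head[OF \<open>c \<in> arcs T\<close>] depth_head[OF \<open>c' \<in> arcs T\<close>]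
        by (simp add: forget_sign_def)
    next
      case e: (edge s')
      then show False
        using up edge[of s c] by (simp add: forget_sign_def)
    qed
  next
    case e: (edge s)
    show False
      using joins(2)
    proof (cases rule: fold_map_link_cases)
      case (down s' c')
      then show False
        using e edge[of s' c'] by (auto simp: forget_sign_def)
    next
      case (up s' c')
      then show False using e sub by simp
    next
      case (edge s')
      then show False using e xz by auto
    qed
  qed
qed

lemma generalized_graph_map_fold_map: "generalized_graph_map T F T F fold_map"
proof -
  have "(vmap i (head T b), head T b, 1) \<in> verts (quiver fold_map)"
    using b(1) by (simp add: fold_map_vert_iff lift_vert_def subtree.base)
  then show ?thesis
    unfolding generalized_graph_map_def
    using fold_map_subnetwork fold_map_complete fold_map_connected
      fold_map_triangle_free fold_map_involution_free by blast
qed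

end

text \<open>In \<open>fold_map\<close> the top of sheet \<open>1\<close> is the required vertex.
  Conversely, such a vertex yields simulating siblings and hence a retraction.\<close>

lemma ex_retraction_iff_graph_map:
  "(\<exists>i. retraction i) \<longleftrightarrow>
    (\<exists>G. generalized_graph_map T F T F G \<and>
       (\<exists>(n1, n2) \<in> forget_sign ` verts (quiver G).
          n1 \<noteq> tree_root T \<and> n2 \<noteq> tree_root T \<and> n1 \<noteq> n2 \<and> parent T n1 = parent T n2 \<and>
          amap F (parent_arc T n1) = amap F (parent_arc T n2)))"
  (is "_ \<longleftrightarrow> (\<exists>G. ?P G)")
proof
  assume "\<exists>i. retraction i"
  then obtain i b where i: "retraction i"
    and b: "b \<in> arcs T" "vmap i (tail T b) = tail T b" "vmap i (head T b) \<noteq> head T b"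
    using retraction_first_moved by blast
  have "(vmap i (head T b), head T b, 1) \<in> verts (quiver (fold_map i b))"
    using b(1) by (simp add: fold_map_vert_iff[OF i b] lift_vert_def[OF i b] subtree.base)
  then have "(vmap i (head T b), head T b) \<in> forget_sign ` verts (quiver (fold_map i b))"
    by (rule rev_image_eqI) (simp add: forget_sign_def)
  then have "?P (fold_map i b)"
    using generalized_graph_map_fold_map[OF i b] head_b_not_root[OF i b] parent_head_b[OF i b] b(3)
    by (intro conjI bexI[of _ "(vmap i (head T b), head T b)"]) auto
  then show "\<exists>G. ?P G" ..
next
  assume "\<exists>G. ?P G"
  then obtain G n m j where G: "generalized_graph_map T F T F G" "(n, m, j) \<in> verts (quiver G)"
    "n \<noteq> tree_root T" "m \<noteq> tree_root T" "n \<noteq> m" "parent T n = parent T m"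
    "amap F (parent_arc T n) = amap F (parent_arc T m)"
    by (auto simp: forget_sign_def)
  have "(n, m, j) \<in> verts (quiver (covering_network T F T F))"
    using G(1,2) by (auto simp: generalized_graph_map_def subnetwork_def subgraph_def)
  then have "n \<in> verts T" "m \<in> verts T" by (simp_all add: covering_vert_iff)
  then have "simulating_siblings (parent_arc T n) (parent_arc T m)"
    using parent_arc[of n] parent_arc[of m] G graph_map_simulates[OF G(1,2)]
    by (auto simp: simulating_siblings_def parent_def)
  then show "\<exists>i. retraction i" by (rule ex_retraction)
qed

end

theorem theorem4p5:
  fixes Q :: "('q, 'a) pre_digraph" and rho :: "('q, 'a) path set"
    and T :: "('n, 'e) pre_digraph" and F :: "('n, 'e, 'q, 'a) qmor"
    and M :: "('q, 'a, 'n \<Rightarrow>\<^sub>0 'k::field) representation"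
  assumes "CHAR('k) \<noteq> 2"
    and "quiver_with_relations TYPE('k) Q rho"
    and "rooted_tree_over TYPE('k) Q rho T F"
    and "M = rooted_tree_module T F"
  shows "(indecomposable pscale Q rho M \<longleftrightarrow>
            \<not> (\<exists>i. quiver_morphism T T i \<and> qmor_eq T (qmor_comp i i) i \<and>
                   \<not> qmor_eq T i qmor_id \<and> qmor_eq T (qmor_comp F i) F)) \<and>
         (\<not> (\<exists>i. quiver_morphism T T i \<and> qmor_eq T (qmor_comp i i) i \<and>
                   \<not> qmor_eq T i qmor_id \<and> qmor_eq T (qmor_comp F i) F) \<longleftrightarrow>
            \<not> (\<exists>G. generalized_graph_map T F T F G \<and>
                   (\<exists>(n1, n2) \<in> forget_sign ` verts (quiver G).
                      n1 \<noteq> tree_root T \<and> n2 \<noteq> tree_root T \<and> n1 \<noteq> n2 \<and> parent T n1 = parent T n2 \<and>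
                      amap F (parent_arc T n1) = amap F (parent_arc T n2))))"
proof -
  have "fin_digraph T" "rooted_tree T" "quiver_morphism T Q F" "wf_digraph Q"
    using assms(2,3)
    by (simp_all add: quiver_with_relations_def rooted_tree_over_def rooted_tree_def
        undirected_tree_def bound_morphism_def)
  then interpret labelled_tree T Q F
    by (simp add: labelled_tree_def rooted_tree_digraph_def rooted_tree_digraph_axioms_def
        labelled_tree_axioms_def)
  have rep: "is_representation pscale Q rho M"
    unfolding assms(4) by (rule rooted_tree_module_is_representation[OF assms(3)])
  have "\<not> is_zero Q (space M)"
  proof -
    have "basis_vector (tree_root T) \<in> space M (vmap F (tree_root T))"
      unfolding assms(4) by (rule basis_vector_in_space[OF root_in_verts])
    moreover have "basis_vector (tree_root T) \<noteq> (0 :: 'n \<Rightarrow>\<^sub>0 'k)"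
      by (metis basis_vector_def lookup_single_eq lookup_zero zero_neq_one)
    ultimately show ?thesis using vmap_in_verts[OF root_in_verts] by (auto simp: is_zero_def)
  qed
  \<comment> \<open>A retraction splits the module; without one there are no simulating siblings,
    and then one summand of any decomposition is zero.\<close>
  then have "indecomposable pscale Q rho M \<longleftrightarrow> \<not> (\<exists>i. retraction i)"
    using rep decomposable_of_retraction[where 'k = 'k] indecomposable_of_no_siblings[where 'k = 'k]
      ex_retraction_iff
    unfolding indecomposable_def assms(4) by metis
  then show ?thesis
    unfolding ex_retraction_iff_graph_map[symmetric] by (simp add: retraction_def)
qed

end
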